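(* Let $q$ be a prime power and $n\ge2$ with $\gcd(q,n)=1$. Let $C\subset\mathbb{F}_qD_n$ be a dihedral code. Then $C$ has a generating matrix of the form $$\left(\begin{array}{c|c}G_{1}&0\\0&G_{2}\\\hline G_{3}&G_{4}\end{array}\right)$$ (each block having $n$ columns), where $G_1,G_2$ are generating matrices of one and the same cyclic code of length $n$ (so $G_2=S_1G_1$ with $S_1$ invertible) and $G_3,G_4$ are generating matrices of one and the same cyclic code of length $n$ (so $G_4=S_2G_3$ with $S_2$ invertible), such that $$\left(\begin{array}{c|c}G_{1}&0\\0&G_{2}\\\hline G_{3}&0\\0&G_{4}\end{array}\right)$$ is a generating matrix of $C_{ext}$ and $$\left(\begin{array}{c|c}G_{1}&0\\0&G_{2}\end{array}\right)$$ is a generating matrix of $C_{int}$.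
   Context: $D_n=\langle a,b\mid a^n=1,\ b^2=1,\ bab=a^{-1}\rangle$ is the dihedral group of order $2n$, $\mathbb{F}_qD_n$ its group algebra; every element is uniquely $P(a)+bQ(a)$ with $P,Q\in\mathbb{F}_q[x]$ of degree less than $n$. A dihedral code is a left ideal of $\mathbb{F}_qD_n$. $\mathbb{F}_q\langle a\rangle\subset\mathbb{F}_qD_n$ is the group algebra of the cyclic subgroup generated by $a$, and $\mathrm{pr}_a:\mathbb{F}_qD_n\to\mathbb{F}_q\langle a\rangle$ is $P(a)+bQ(a)\mapsto P(a)$. For a dihedral code $C$: $C_{ext}=(\mathbb{F}_qD_n)\,\mathrm{pr}_a(C)$ (exterior induced code) and $C_{int}=(\mathbb{F}_qD_n)(C\cap\mathbb{F}_q\langle a\rangle)$ (interior induced code), the left ideals generated by the indicated sets. Let $\phi:\mathbb{F}_qD_n\to\mathbb{F}_q^{2n}$ be the linear isomorphism with $\phi(a^i)=\mathbf{e}_{i+1}$, $\phi(ba^i)=\mathbf{e}_{n+i+1}$ ($0\le i\le n-1$), where $\mathbf e_k$ are standard basis vectors. A generating matrix of a code $I\subset\mathbb{F}_qD_n$ is a matrix whose rows are $\phi(s_1),\dots,\phi(s_k)$ for an $\mathbb{F}_q$-basis $s_1,\dots,s_k$ of $I$. A cyclic code of length $n$ is the image of an ideal of $\mathbb{F}_q\langle a\rangle$ under $\psi:\mathbb{F}_q\langle a\rangle\to\mathbb{F}_q^n$, $\psi(a^i)=\mathbf{e}_{i+1}$, and a generating matrix of it is a matrix whose rows form a basis. Blocks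 may have zero rows (generating matrix of the zero code). *)

theory Defs
  imports
    "Jordan_Normal_Form.VS_Connect"
    "HOL-Algebra.Generated_Groups"
    "HOL-Algebra.Ideal"
    "HOL-Library.Cardinality"
begin

text \<open>
  The algebra over the field \<open>'k\<close> of a finite group \<open>G\<close>: an element is its coefficient
  function, extended by \<open>0\<close> outside \<open>carrier G\<close>.  Consequently the algebra of a subgroup is
  literally a subset of the algebra of the whole group.
\<close>

definition group_algebra :: "('g, 'm) monoid_scheme \<Rightarrow> ('k::field, 'g \<Rightarrow> 'k) module" where
  "group_algebra G =
     \<lparr>carrier = {f. \<forall>x. x \<notin> carrier G \<longrightarrow> f x = 0},
      mult = (\<lambda>f g x. \<Sum>y\<in>carrier G. \<Sum>z\<in>carrier G. if y \<otimes>\<^bsub>G\<^esub> z = x then f y * g z else 0),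
      one = (\<lambda>x. if x = \<one>\<^bsub>G\<^esub> then 1 else 0),
      zero = (\<lambda>x. 0),
      add = (\<lambda>f g x. f x + g x),
      smult = (\<lambda>c f x. c * f x)\<rparr>"

definition basis_elem :: "'g \<Rightarrow> 'g \<Rightarrow> 'k::field" where
  "basis_elem g = (\<lambda>x. if x = g then 1 else 0)"

definition left_ideal :: "'r set \<Rightarrow> ('r, 'm) ring_scheme \<Rightarrow> bool" where
  "left_ideal I R \<longleftrightarrow> additive_subgroup I R \<and> (\<forall>r\<in>carrier R. \<forall>x\<in>I. r \<otimes>\<^bsub>R\<^esub> x \<in> I)"

definition left_ideal_generated :: "('r, 'm) ring_scheme \<Rightarrow> 'r set \<Rightarrow> 'r set" where
  "left_ideal_generated R S = \<Inter>{I. left_ideal I R \<and> S \<subseteq> I}"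

text \<open>
  The pair \<open>(s, i)\<close> with \<open>i < n\<close> stands for \<open>a\<^sup>i\<close> if \<open>s = False\<close> and for \<open>b a\<^sup>i\<close> if \<open>s = True\<close>.
  The product formula comes from \<open>a\<^sup>i b = b a\<^sup>-\<^sup>i\<close>.
\<close>

definition dihedral :: "nat \<Rightarrow> (bool \<times> nat) monoid" where
  "dihedral n =
     \<lparr>carrier = UNIV \<times> {..<n},
      mult = (\<lambda>(s, i) (t, j). (s \<noteq> t, (if t then (n - i) + j else i + j) mod n)),
      one = (False, 0)\<rparr>"

definition gen_a :: "bool \<times> nat" where "gen_a = (False, 1)"
definition gen_b :: "bool \<times> nat" where "gen_b = (True, 0)"

definition rotations :: "nat \<Rightarrow> (bool \<times> nat) set" where
  "rotations n = generate (dihedral n) {gen_a}"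

definition dihedral_algebra :: "nat \<Rightarrow> ('k::field, bool \<times> nat \<Rightarrow> 'k) module" where
  "dihedral_algebra n = group_algebra (dihedral n)"

definition cyclic_algebra :: "nat \<Rightarrow> ('k::field, bool \<times> nat \<Rightarrow> 'k) module" where
  "cyclic_algebra n = group_algebra ((dihedral n)\<lparr>carrier := rotations n\<rparr>)"

definition dihedral_code :: "nat \<Rightarrow> (bool \<times> nat \<Rightarrow> 'k::field) set \<Rightarrow> bool" where
  "dihedral_code n C \<longleftrightarrow> left_ideal C (dihedral_algebra n)"

definition pr_a :: "nat \<Rightarrow> (bool \<times> nat \<Rightarrow> 'k::field) \<Rightarrow> (bool \<times> nat \<Rightarrow> 'k)" where
  "pr_a n f = (\<lambda>x. if x \<in> rotations n then f x else 0)"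

definition C_ext :: "nat \<Rightarrow> (bool \<times> nat \<Rightarrow> 'k::field) set \<Rightarrow> (bool \<times> nat \<Rightarrow> 'k) set" where
  "C_ext n C = left_ideal_generated (dihedral_algebra n) (pr_a n ` C)"

definition C_int :: "nat \<Rightarrow> (bool \<times> nat \<Rightarrow> 'k::field) set \<Rightarrow> (bool \<times> nat \<Rightarrow> 'k) set" where
  "C_int n C = left_ideal_generated (dihedral_algebra n) (C \<inter> carrier (cyclic_algebra n))"

definition phi :: "nat \<Rightarrow> (bool \<times> nat \<Rightarrow> 'k::field) \<Rightarrow> 'k vec" where
  "phi n f = vec (2 * n) (\<lambda>k. if k < n then f (False, k) else f (True, k - n))"

definition psi :: "nat \<Rightarrow> (bool \<times> nat \<Rightarrow> 'k::field) \<Rightarrow> 'k vec" where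
  "psi n f = vec n (\<lambda>k. f (False, k))"

definition cyclic_code :: "nat \<Rightarrow> 'k::field vec set \<Rightarrow> bool" where
  "cyclic_code n D \<longleftrightarrow> (\<exists>J. ideal J (cyclic_algebra n) \<and> D = psi n ` J)"

text \<open>
  A subspace \<open>W\<close> of a vector space \<open>V\<close> is itself the vector space \<open>V\<lparr>carrier := W\<rparr>\<close>.
  A matrix with zero rows generates the zero code.
\<close>

definition generating_matrix :: "nat \<Rightarrow> (bool \<times> nat \<Rightarrow> 'k::field) set \<Rightarrow> 'k mat \<Rightarrow> bool" where
  "generating_matrix n I M \<longleftrightarrow>
     (\<exists>ss. distinct ss \<and>
           vectorspace.basis class_ring ((dihedral_algebra n)\<lparr>carrier := I\<rparr>) (set ss) \<and>
           M = mat_of_rows (2 * n) (map (phi n) ss))"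

definition cyclic_generating_matrix :: "nat \<Rightarrow> 'k::field vec set \<Rightarrow> 'k mat \<Rightarrow> bool" where
  "cyclic_generating_matrix n D G \<longleftrightarrow>
     dim_col G = n \<and> distinct (rows G) \<and>
     vectorspace.basis class_ring ((module_vec TYPE('k) n)\<lparr>carrier := D\<rparr>) (set (rows G))"

definition append_cols :: "'k::zero mat \<Rightarrow> 'k mat \<Rightarrow> 'k mat" where
  "append_cols A B = four_block_mat A B (0\<^sub>m 0 (dim_col A)) (0\<^sub>m 0 (dim_col B))"

lemma dihedral_simps [simp]:
  "carrier (dihedral n) = UNIV \<times> {..<n}"
  "(s, i) \<otimes>\<^bsub>dihedral n\<^esub> (t, j) = (s \<noteq> t, (if t then (n - i) + j else i + j) mod n)"
  "\<one>\<^bsub>dihedral n\<^esub> = (False, 0)"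
  by (simp_all add: dihedral_def)

lemma dihedral_index_int:
  fixes n i j :: nat
  assumes "i < n"
  shows "int ((if t then (n - i) + j else i + j) mod n) =
    ((if t then - int i else int i) + int j) mod int n"
proof (cases t)
  case True
  have "int ((n - i) + j) = int n + (- int i + int j)"
    using assms by simp
  then have "int ((n - i) + j) mod int n = (- int i + int j) mod int n"
    by (simp only: mod_add_self1)
  with True show ?thesis by (simp add: zmod_int)
qed (simp add: zmod_int)

lemma dihedral_assoc_aux:
  fixes n i j k :: nat
  assumes "i < n" "j < n"
  defines "m \<equiv> \<lambda>i t j. (if t then (n - i) + j else i + j) mod n"
  shows "m (m i t j) u k = m i (t \<noteq> u) (m j u k)"
proof -
  have m: "int (m x v y) = ((if v then - int x else int x) + int y) mod int n" if "x < n" for x v y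
    unfolding m_def by (rule dihedral_index_int) fact
  have lt: "m x v y < n" for x v y
    using assms(1) by (simp add: m_def)
  have "int (m (m i t j) u k) = int (m i (t \<noteq> u) (m j u k))"
    unfolding m[OF lt] m[OF assms(1)] m[OF assms(2)]
    by (cases t; cases u) (simp_all add: mod_simps algebra_simps)
  then show ?thesis by simp
qed

lemma group_dihedral:
  assumes "0 < n"
  shows "group (dihedral n)"
proof (rule groupI)
  fix x assume "x \<in> carrier (dihedral n)"
  then obtain s i where x: "x = (s, i)" "i < n" by auto
  show "\<exists>y\<in>carrier (dihedral n). y \<otimes>\<^bsub>dihedral n\<^esub> x = \<one>\<^bsub>dihedral n\<^esub>"
    using x assms by (intro bexI[of _ "if s then x else (False, (n - i) mod n)"])
      (auto simp: mod_simps)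
next
  fix x y z
  assume "x \<in> carrier (dihedral n)" "y \<in> carrier (dihedral n)" "z \<in> carrier (dihedral n)"
  then obtain s i t j u k where xyz: "x = (s, i)" "y = (t, j)" "z = (u, k)" "i < n" "j < n"
    by auto
  show "x \<otimes>\<^bsub>dihedral n\<^esub> y \<otimes>\<^bsub>dihedral n\<^esub> z = x \<otimes>\<^bsub>dihedral n\<^esub> (y \<otimes>\<^bsub>dihedral n\<^esub> z)"
    unfolding xyz dihedral_simps prod.inject using dihedral_assoc_aux[OF xyz(4,5)] by blast
qed (use assms in auto)

lemma card_dihedral: "card (carrier (dihedral n)) = 2 * n"
  by (simp add: card_cartesian_product)

lemma gen_a_pow:
  assumes "2 \<le> n"
  shows "gen_a [^]\<^bsub>dihedral n\<^esub> (i::nat) = (False, i mod n)"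
proof -
  interpret group "dihedral n" using assms by (intro group_dihedral) auto
  show ?thesis
    by (induction i) (use assms in \<open>simp_all add: gen_a_def mod_Suc_eq\<close>)
qed

lemma dihedral_relations:
  assumes "2 \<le> n"
  shows "gen_a [^]\<^bsub>dihedral n\<^esub> n = \<one>\<^bsub>dihedral n\<^esub>"
    and "gen_b \<otimes>\<^bsub>dihedral n\<^esub> gen_b = \<one>\<^bsub>dihedral n\<^esub>"
    and "gen_b \<otimes>\<^bsub>dihedral n\<^esub> gen_a \<otimes>\<^bsub>dihedral n\<^esub> gen_b = inv\<^bsub>dihedral n\<^esub> gen_a"
    and "i < n \<Longrightarrow> gen_a [^]\<^bsub>dihedral n\<^esub> i = (False, i)"
    and "i < n \<Longrightarrow> gen_b \<otimes>\<^bsub>dihedral n\<^esub> gen_a [^]\<^bsub>dihedral n\<^esub> i = (True, i)"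
proof -
  interpret group "dihedral n" using assms by (intro group_dihedral) auto
  show "gen_b \<otimes>\<^bsub>dihedral n\<^esub> gen_a \<otimes>\<^bsub>dihedral n\<^esub> gen_b = inv\<^bsub>dihedral n\<^esub> gen_a"
    by (rule inv_equality[symmetric]) (use assms in \<open>auto simp: gen_a_def gen_b_def\<close>)
qed (use assms in \<open>auto simp: gen_a_pow gen_b_def\<close>)

lemma rotations_eq:
  assumes "2 \<le> n"
  shows "rotations n = {False} \<times> {..<n}"
proof -
  interpret group "dihedral n" using assms by (intro group_dihedral) auto
  have a: "gen_a \<in> carrier (dihedral n)" using assms by (auto simp: gen_a_def)
  have "x \<in> {False} \<times> {..<n}" if "x \<in> generate (dihedral n) {gen_a}" for x
    using that
  proof induction
    case (inv h)
    then have "inv\<^bsub>dihedral n\<^esub> h = gen_b \<otimes>\<^bsub>dihedral n\<^esub> gen_a \<otimes>\<^bsub>dihedral n\<^esub> gen_b"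
      using dihedral_relations(3)[OF assms] by simp
    then show ?case using assms by (simp add: gen_a_def gen_b_def)
  qed (use assms in \<open>auto simp: gen_a_def\<close>)
  moreover have "(False, i) \<in> generate (dihedral n) {gen_a}" if "i < n" for i
  proof -
    have "gen_a [^]\<^bsub>dihedral n\<^esub> int i \<in> generate (dihedral n) {gen_a}"
      unfolding generate_pow[OF a] by blast
    then show ?thesis by (simp add: int_pow_int dihedral_relations(4)[OF assms that])
  qed
  ultimately show ?thesis by (auto simp: rotations_def)
qed

lemma group_algebra_simps [simp]:
  "carrier (group_algebra G) = {f. \<forall>x. x \<notin> carrier G \<longrightarrow> f x = 0}"
  "\<one>\<^bsub>group_algebra G\<^esub> = basis_elem \<one>\<^bsub>G\<^esub>"
  "\<zero>\<^bsub>group_algebra G\<^esub> = (\<lambda>x. 0)"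
  "f \<oplus>\<^bsub>group_algebra G\<^esub> g = (\<lambda>x. f x + g x)"
  "c \<odot>\<^bsub>group_algebra G\<^esub> f = (\<lambda>x. c * f x)"
  by (simp_all add: group_algebra_def basis_elem_def)

lemma group_algebra_mult:
  assumes "group G" "finite (carrier G)"
  shows "(f \<otimes>\<^bsub>group_algebra G\<^esub> g) x =
    (if x \<in> carrier G then \<Sum>y\<in>carrier G. f y * g (inv\<^bsub>G\<^esub> y \<otimes>\<^bsub>G\<^esub> x) else 0)"
proof -
  interpret group G by fact
  have "(\<Sum>z\<in>carrier G. if y \<otimes>\<^bsub>G\<^esub> z = x then f y * g z else 0) =
        (if x \<in> carrier G then f y * g (inv\<^bsub>G\<^esub> y \<otimes>\<^bsub>G\<^esub> x) else 0)" if y: "y \<in> carrier G" for y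
  proof (cases "x \<in> carrier G")
    case True
    have "(y \<otimes>\<^bsub>G\<^esub> z = x) = (z = inv\<^bsub>G\<^esub> y \<otimes>\<^bsub>G\<^esub> x)" if "z \<in> carrier G" for z
      using that y True by (metis inv_solve_left)
    then have "(\<Sum>z\<in>carrier G. if y \<otimes>\<^bsub>G\<^esub> z = x then f y * g z else 0) =
      (\<Sum>z\<in>carrier G. if z = inv\<^bsub>G\<^esub> y \<otimes>\<^bsub>G\<^esub> x then f y * g z else 0)"
      by (intro sum.cong) auto
    then show ?thesis using True y assms by simp
  qed (use y in \<open>auto intro!: sum.neutral\<close>)
  then show ?thesis by (auto simp: group_algebra_def intro!: sum.cong sum.neutral)
qed

lemma basis_elem_mult:
  assumes "finite (carrier G)" "g \<in> carrier G" "h \<in> carrier G"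
  shows "basis_elem g \<otimes>\<^bsub>group_algebra G\<^esub> basis_elem h = (basis_elem (g \<otimes>\<^bsub>G\<^esub> h) :: _ \<Rightarrow> 'k::field)"
proof
  fix x
  have "(basis_elem g \<otimes>\<^bsub>group_algebra G\<^esub> basis_elem h) x =
    (\<Sum>y\<in>carrier G. \<Sum>z\<in>carrier G. if y \<otimes>\<^bsub>G\<^esub> z = x then basis_elem g y * basis_elem h z else (0::'k))"
    by (simp add: group_algebra_def)
  also have "\<dots> =
    (\<Sum>y\<in>carrier G. \<Sum>z\<in>carrier G. if z = h then (if y = g then if g \<otimes>\<^bsub>G\<^esub> h = x then 1 else 0 else 0) else (0::'k))"
    by (intro sum.cong refl) (auto simp: basis_elem_def)
  also have "\<dots> = basis_elem (g \<otimes>\<^bsub>G\<^esub> h) x"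
    using assms by (simp add: basis_elem_def)
  finally show "(basis_elem g \<otimes>\<^bsub>group_algebra G\<^esub> basis_elem h) x = (basis_elem (g \<otimes>\<^bsub>G\<^esub> h) x :: 'k)" .
qed

lemma phi_basis_elem:
  assumes "2 \<le> n" "i < n"
  shows "phi n (basis_elem (gen_a [^]\<^bsub>dihedral n\<^esub> i)) = unit_vec (2 * n) i"
    and "phi n (basis_elem (gen_b \<otimes>\<^bsub>dihedral n\<^esub> gen_a [^]\<^bsub>dihedral n\<^esub> i)) = unit_vec (2 * n) (n + i)"
proof -
  show "phi n (basis_elem (gen_a [^]\<^bsub>dihedral n\<^esub> i)) = unit_vec (2 * n) i"
    unfolding dihedral_relations(4)[OF assms]
    by (rule eq_vecI) (use assms in \<open>auto simp: phi_def basis_elem_def\<close>)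
  show "phi n (basis_elem (gen_b \<otimes>\<^bsub>dihedral n\<^esub> gen_a [^]\<^bsub>dihedral n\<^esub> i)) = unit_vec (2 * n) (n + i)"
    unfolding dihedral_relations(5)[OF assms]
    by (rule eq_vecI) (use assms in \<open>auto simp: phi_def basis_elem_def\<close>)
qed

lemma psi_basis_elem:
  assumes "2 \<le> n" "i < n"
  shows "psi n (basis_elem (gen_a [^]\<^bsub>dihedral n\<^esub> i)) = unit_vec n i"
  unfolding dihedral_relations(4)[OF assms]
  using assms by (auto simp: psi_def basis_elem_def unit_vec_def)

lemma abelian_group_group_algebra: "abelian_group (group_algebra G)"
proof (rule abelian_groupI)
  fix f assume "f \<in> carrier (group_algebra G)"
  then show "\<exists>g\<in>carrier (group_algebra G). g \<oplus>\<^bsub>group_algebra G\<^esub> f = \<zero>\<^bsub>group_algebra G\<^esub>"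
    by (intro bexI[of _ "\<lambda>x. - f x"]) auto
qed (auto simp: algebra_simps)

lemma ring_group_algebra:
  assumes "group G" "finite (carrier G)"
  shows "ring (group_algebra G :: ('k::field, _) module)"
proof -
  interpret group G by fact
  let ?A = "group_algebra G :: ('k, _) module"
  note mult = group_algebra_mult[OF assms]
  have reidx: "(\<Sum>z\<in>carrier G. F (y \<otimes>\<^bsub>G\<^esub> z)) = (\<Sum>z\<in>carrier G. F z)" if "y \<in> carrier G" for y and F :: "_ \<Rightarrow> 'k"
    by (rule sum.reindex_bij_witness[of _ "\<lambda>z. inv\<^bsub>G\<^esub> y \<otimes>\<^bsub>G\<^esub> z" "\<lambda>z. y \<otimes>\<^bsub>G\<^esub> z"])
      (use that in \<open>auto simp: m_assoc[symmetric]\<close>)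
  have assoc: "(f \<otimes>\<^bsub>?A\<^esub> g) \<otimes>\<^bsub>?A\<^esub> h = f \<otimes>\<^bsub>?A\<^esub> (g \<otimes>\<^bsub>?A\<^esub> h)" for f g h
  proof
    fix x
    show "((f \<otimes>\<^bsub>?A\<^esub> g) \<otimes>\<^bsub>?A\<^esub> h) x = (f \<otimes>\<^bsub>?A\<^esub> (g \<otimes>\<^bsub>?A\<^esub> h)) x"
    proof (cases "x \<in> carrier G")
      case x: True
      have "((f \<otimes>\<^bsub>?A\<^esub> g) \<otimes>\<^bsub>?A\<^esub> h) x =
        (\<Sum>z\<in>carrier G. \<Sum>y\<in>carrier G. f y * g (inv\<^bsub>G\<^esub> y \<otimes>\<^bsub>G\<^esub> z) * h (inv\<^bsub>G\<^esub> z \<otimes>\<^bsub>G\<^esub> x))"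
        using x by (simp add: mult sum_distrib_right)
      also have "\<dots> = (\<Sum>y\<in>carrier G. \<Sum>z\<in>carrier G. f y * g (inv\<^bsub>G\<^esub> y \<otimes>\<^bsub>G\<^esub> z) * h (inv\<^bsub>G\<^esub> z \<otimes>\<^bsub>G\<^esub> x))"
        by (rule sum.swap)
      also have "\<dots> = (\<Sum>y\<in>carrier G. \<Sum>z\<in>carrier G. f y * g z * h (inv\<^bsub>G\<^esub> z \<otimes>\<^bsub>G\<^esub> (inv\<^bsub>G\<^esub> y \<otimes>\<^bsub>G\<^esub> x)))"
      proof (rule sum.cong[OF refl])
        fix y assume y: "y \<in> carrier G"
        have "(\<Sum>z\<in>carrier G. f y * g (inv\<^bsub>G\<^esub> y \<otimes>\<^bsub>G\<^esub> z) * h (inv\<^bsub>G\<^esub> z \<otimes>\<^bsub>G\<^esub> x)) =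
          (\<Sum>z\<in>carrier G. f y * g (inv\<^bsub>G\<^esub> y \<otimes>\<^bsub>G\<^esub> (y \<otimes>\<^bsub>G\<^esub> z)) * h (inv\<^bsub>G\<^esub> (y \<otimes>\<^bsub>G\<^esub> z) \<otimes>\<^bsub>G\<^esub> x))"
          by (rule reidx[OF y, symmetric])
        also have "\<dots> = (\<Sum>z\<in>carrier G. f y * g z * h (inv\<^bsub>G\<^esub> z \<otimes>\<^bsub>G\<^esub> (inv\<^bsub>G\<^esub> y \<otimes>\<^bsub>G\<^esub> x)))"
        proof (intro sum.cong refl)
          fix z assume z: "z \<in> carrier G"
          have "inv\<^bsub>G\<^esub> y \<otimes>\<^bsub>G\<^esub> (y \<otimes>\<^bsub>G\<^esub> z) = z" using y z by (simp flip: m_assoc)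
          then show "f y * g (inv\<^bsub>G\<^esub> y \<otimes>\<^bsub>G\<^esub> (y \<otimes>\<^bsub>G\<^esub> z)) * h (inv\<^bsub>G\<^esub> (y \<otimes>\<^bsub>G\<^esub> z) \<otimes>\<^bsub>G\<^esub> x) =
            f y * g z * h (inv\<^bsub>G\<^esub> z \<otimes>\<^bsub>G\<^esub> (inv\<^bsub>G\<^esub> y \<otimes>\<^bsub>G\<^esub> x))"
            using x y z by (simp add: inv_mult_group m_assoc)
        qed
        finally show "(\<Sum>z\<in>carrier G. f y * g (inv\<^bsub>G\<^esub> y \<otimes>\<^bsub>G\<^esub> z) * h (inv\<^bsub>G\<^esub> z \<otimes>\<^bsub>G\<^esub> x)) = \<dots>" .
      qed
      also have "\<dots> = (f \<otimes>\<^bsub>?A\<^esub> (g \<otimes>\<^bsub>?A\<^esub> h)) x"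
        using x by (simp add: mult sum_distrib_left mult.assoc)
      finally show ?thesis .
    qed (simp add: mult)
  qed
  have one_l: "\<one>\<^bsub>?A\<^esub> \<otimes>\<^bsub>?A\<^esub> f = f" if "f \<in> carrier ?A" for f
  proof
    fix x
    have "x \<in> carrier G \<Longrightarrow> (\<Sum>y\<in>carrier G. basis_elem \<one>\<^bsub>G\<^esub> y * f (inv\<^bsub>G\<^esub> y \<otimes>\<^bsub>G\<^esub> x)) =
      (\<Sum>y\<in>carrier G. if y = \<one>\<^bsub>G\<^esub> then f x else 0)"
      by (intro sum.cong refl) (auto simp: basis_elem_def)
    then show "(\<one>\<^bsub>?A\<^esub> \<otimes>\<^bsub>?A\<^esub> f) x = f x"
      using that assms by (simp add: mult)
  qed
  have one_r: "f \<otimes>\<^bsub>?A\<^esub> \<one>\<^bsub>?A\<^esub> = f" if "f \<in> carrier ?A" for f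
  proof
    fix x
    have "(\<Sum>y\<in>carrier G. f y * basis_elem \<one>\<^bsub>G\<^esub> (inv\<^bsub>G\<^esub> y \<otimes>\<^bsub>G\<^esub> x)) =
      (\<Sum>y\<in>carrier G. if y = x then f x else 0)" if x: "x \<in> carrier G"
    proof (intro sum.cong refl)
      fix y assume y: "y \<in> carrier G"
      have "(inv\<^bsub>G\<^esub> y \<otimes>\<^bsub>G\<^esub> x = \<one>\<^bsub>G\<^esub>) = (y = x)"
        using x y by (metis inv_solve_left l_inv one_closed r_one)
      then show "f y * basis_elem \<one>\<^bsub>G\<^esub> (inv\<^bsub>G\<^esub> y \<otimes>\<^bsub>G\<^esub> x) = (if y = x then f x else 0)"
        by (auto simp: basis_elem_def)
    qed
    then show "(f \<otimes>\<^bsub>?A\<^esub> \<one>\<^bsub>?A\<^esub>) x = f x"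
      using that assms by (simp add: mult)
  qed
  have closed: "f \<otimes>\<^bsub>?A\<^esub> g \<in> carrier ?A" for f g
    by (simp add: mult)
  have one_closed: "\<one>\<^bsub>?A\<^esub> \<in> carrier ?A"
    by (auto simp: basis_elem_def)
  have distr: "(f \<oplus>\<^bsub>?A\<^esub> g) \<otimes>\<^bsub>?A\<^esub> h = f \<otimes>\<^bsub>?A\<^esub> h \<oplus>\<^bsub>?A\<^esub> g \<otimes>\<^bsub>?A\<^esub> h"
    "h \<otimes>\<^bsub>?A\<^esub> (f \<oplus>\<^bsub>?A\<^esub> g) = h \<otimes>\<^bsub>?A\<^esub> f \<oplus>\<^bsub>?A\<^esub> h \<otimes>\<^bsub>?A\<^esub> g" for f g h
    by (rule ext, simp add: mult distrib_left distrib_right sum.distrib)+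
  have "Group.monoid ?A"
    by (rule Group.monoidI) (rule closed one_closed assoc one_l one_r, assumption?)+
  then show ?thesis
    by (rule ringI[OF abelian_group_group_algebra]) (rule distr)+
qed

lemma vectorspace_group_algebra: "vectorspace class_ring (group_algebra G :: ('k::field, _) module)"
proof -
  have "module class_ring (group_algebra G :: ('k, _) module)"
    by (rule Module.module.intro, rule class_cring.cring_axioms, rule abelian_group_group_algebra,
        unfold_locales) (auto simp: fun_eq_iff algebra_simps)
  then show ?thesis
    by (intro vectorspace.intro class_field.field_axioms)
qed

end

theory Submission
  imports Defs "HOL-Library.Function_Algebras"
begin

text \<open>
  Write \<open>R\<close> for the algebra of the rotation group.  An element \<open>f = P + b Q\<close> of the dihedral
  algebra is determined by \<open>P = pr f\<close> and \<open>Q = pr (b f)\<close>, so a dihedral code \<open>C\<close> is a space of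
  pairs \<open>(P, Q)\<close>.  Left multiplication by \<open>b\<close> swaps the components, and left multiplication by
  \<open>a\<close> sends \<open>(P, Q)\<close> to \<open>(a P, a\<^sup>-\<^sup>1 Q)\<close>.  Hence \<open>D = C \<inter> R\<close> and \<open>E = pr C\<close> are ideals of
  \<open>R\<close>, an ideal \<open>J\<close> of \<open>R\<close> generates the left ideal \<open>J + b J\<close> (\<open>left_ideal_generated_cyclic\<close>),
  and \<open>C\<close> lies between the interior code \<open>D + b D\<close> and the exterior code \<open>E + b E\<close>.

  As \<open>n\<close> is invertible in the field, Maschke's theorem (\<open>invariant_complement\<close>) gives an ideal
  \<open>M\<close> with \<open>E = D \<oplus> M\<close>.  Removing the \<open>D\<close>-parts of both components of an element of \<open>C\<close>
  does not leave \<open>C\<close>, so \<open>C = (D + b D) \<oplus> N\<close> with \<open>N = C \<inter> (M + b M)\<close>.  If one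
  component of an element of \<open>N\<close> vanishes, the other lies in \<open>C \<inter> R \<inter> M = D \<inter> M = 0\<close>.  Both
  projections are therefore isomorphisms from \<open>N\<close> onto \<open>M\<close> (\<open>dihedral_code_decomposition\<close>):
  \<open>N\<close> is the graph of an automorphism of \<open>M\<close>.

  A basis of \<open>D\<close> gives \<open>G\<^sub>1 = G\<^sub>2\<close>, and the two projections of a basis of \<open>N\<close> give \<open>G\<^sub>3\<close> and
  \<open>G\<^sub>4\<close>, which are two bases of \<open>M\<close> and so differ by an invertible matrix.
\<close>

section \<open>Spaces of functions with values in a field\<close>

text \<open>
  Elements of a group algebra are functions.  With pointwise scaling all of them form one vector
  space on the whole function type, so that the codes become subspaces of it.
\<close>

definition fscale :: "'k::field \<Rightarrow> ('x \<Rightarrow> 'k) \<Rightarrow> 'x \<Rightarrow> 'k" where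
  "fscale c f = (\<lambda>x. c * f x)"

lemma fscale_apply [simp]: "fscale c f x = c * f x"
  by (simp add: fscale_def)

interpretation fs: vector_space fscale
  by unfold_locales (auto simp: fun_eq_iff algebra_simps)

interpretation fsp: vector_space_pair fscale fscale
  by unfold_locales

abbreviation flinear :: "(('x \<Rightarrow> 'k::field) \<Rightarrow> ('x \<Rightarrow> 'k)) \<Rightarrow> bool" where
  "flinear \<equiv> Vector_Spaces.linear fscale fscale"

lemma flinearI:
  assumes "\<And>f g. T (f + g) = T f + T g" "\<And>c f. T (fscale c f) = fscale c (T f)"
  shows "flinear T"
  by unfold_locales (fact assms)+

lemma sum_fun_apply: "(\<Sum>i\<in>I. F i) x = (\<Sum>i\<in>I. F i x)" for F :: "'i \<Rightarrow> 'x \<Rightarrow> 'k::comm_monoid_add"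
  by (induction I rule: infinite_finite_induct) auto

text \<open>
  In a vanishing combination of vectors from \<open>A \<union> B\<close>, the part over \<open>A\<close> is the negative of the
  part over \<open>B\<close>; it lies in both spans, so each part vanishes separately.
\<close>

lemma (in vector_space) independent_Un_direct:
  assumes A: "independent A" and B: "independent B" and AB: "span A \<inter> span B = {0}"
  shows "independent (A \<union> B)"
  unfolding independent_explicit_module
proof (intro allI impI)
  fix t u v
  assume t: "finite t" "t \<subseteq> A \<union> B" "(\<Sum>w\<in>t. scale (u w) w) = 0" "v \<in> t"
  define a where "a = (\<Sum>w\<in>t \<inter> A. scale (u w) w)"
  define b where "b = (\<Sum>w\<in>t - A. scale (u w) w)"
  have ab: "a + b = 0"
    using t sum.Int_Diff[of t "\<lambda>w. scale (u w) w" A] by (simp add: a_def b_def)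
  have "a \<in> span A"
    unfolding a_def by (intro span_sum span_scale span_base) auto
  moreover have b: "b \<in> span B"
    unfolding b_def by (intro span_sum span_scale span_base) (use t in auto)
  moreover have "a = - b"
    using ab by (simp add: eq_neg_iff_add_eq_0)
  ultimately have "a \<in> span A \<inter> span B"
    using span_neg[OF b] by simp
  then have "a = 0" "b = 0"
    using AB ab by auto
  then show "u v = 0"
    using independentD[OF A, of "t \<inter> A" u v] independentD[OF B, of "t - A" u v] t
    unfolding a_def b_def by (cases "v \<in> A") auto
qed

text \<open>Bases are lists because they become the rows of a matrix.\<close>

definition basis_list :: "('x \<Rightarrow> 'k::field) set \<Rightarrow> ('x \<Rightarrow> 'k) list \<Rightarrow> bool" where
  "basis_list U bs \<longleftrightarrow> distinct bs \<and> fs.independent (set bs) \<and> fs.span (set bs) = U"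

lemma basis_list_subset: "basis_list U bs \<Longrightarrow> set bs \<subseteq> U"
  unfolding basis_list_def using fs.span_superset by blast

lemma basis_list_subspace: "basis_list U bs \<Longrightarrow> fs.subspace U"
  unfolding basis_list_def using fs.subspace_span by blast

lemma basis_list_exists:
  assumes "fs.subspace U" "finite U"
  obtains bs where "basis_list U bs"
proof -
  obtain B where B: "B \<subseteq> U" "fs.independent B" "U \<subseteq> fs.span B"
    by (rule fs.maximal_independent_subset)
  obtain bs where "distinct bs" "set bs = B"
    using finite_distinct_list[OF finite_subset[OF B(1) assms(2)]] by blast
  moreover have "fs.span B = U"
    using fs.span_minimal[OF B(1) assms(1)] B(3) by blast
  ultimately show ?thesis
    using B that[of bs] by (simp add: basis_list_def)
qed

lemma basis_list_map:
  assumes "basis_list U bs" "flinear T" "inj_on T U"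
  shows "basis_list (T ` U) (map T bs)"
proof -
  interpret T: Vector_Spaces.linear fscale fscale T by fact
  show ?thesis
    using assms T.independent_injective_image[of "set bs"] basis_list_subset[OF assms(1)]
    by (auto simp: basis_list_def distinct_map T.span_image intro: inj_on_subset)
qed

lemma basis_list_append:
  assumes as: "basis_list U as" and bs: "basis_list W bs" and UW: "U \<inter> W = {0}"
  shows "basis_list {x + y |x y. x \<in> U \<and> y \<in> W} (as @ bs)"
proof -
  have "0 \<notin> set as"
    using as fs.dependent_zero by (auto simp: basis_list_def)
  moreover have "set as \<inter> set bs \<subseteq> U \<inter> W"
    by (intro Int_mono basis_list_subset as bs)
  ultimately have "set as \<inter> set bs = {}"
    unfolding UW by blast
  moreover have "fs.independent (set as \<union> set bs)"
    using as bs UW by (intro fs.independent_Un_direct) (auto simp: basis_list_def)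
  ultimately show ?thesis
    using as bs by (simp add: basis_list_def fs.span_Un)
qed

lemma basis_list_expand:
  assumes "basis_list U as" "v \<in> U"
  obtains c where "v = (\<Sum>j<length as. fscale (c j) (as ! j))"
proof -
  have "v = (\<Sum>a\<in>set as. fscale (fs.representation (set as) v a) a)"
    using assms by (subst fs.sum_representation_eq) (auto simp: basis_list_def)
  also have "\<dots> = (\<Sum>j<length as. fscale (fs.representation (set as) v (as ! j)) (as ! j))"
    using assms(1) bij_betw_nth[of as "{..<length as}" "set as"]
    by (intro sum.reindex_bij_betw[symmetric]) (auto simp: basis_list_def)
  finally show ?thesis by (rule that)
qed

lemma basis_list_coeffs_unique:
  assumes as: "basis_list U as"
    and eq: "(\<Sum>j<length as. fscale (c j) (as ! j)) = (\<Sum>j<length as. fscale (d j) (as ! j))"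
    and j: "j < length as"
  shows "c j = d j"
proof -
  have d: "distinct as" and ind: "fs.independent (set as)"
    using as by (auto simp: basis_list_def)
  define idx where "idx = the_inv_into {..<length as} ((!) as)"
  have bij: "bij_betw ((!) as) {..<length as} (set as)"
    using d bij_betw_nth by blast
  have idx: "idx (as ! i) = i" if "i < length as" for i
    unfolding idx_def using bij that by (intro the_inv_into_f_f) (auto simp: bij_betw_def)
  have "0 = (\<Sum>j<length as. fscale (c (idx (as ! j)) - d (idx (as ! j))) (as ! j))"
    using eq by (simp add: idx fs.scale_left_diff_distrib sum_subtractf)
  also have "\<dots> = (\<Sum>a\<in>set as. fscale (c (idx a) - d (idx a)) a)"
    by (rule sum.reindex_bij_betw[OF bij])
  finally have "c (idx (as ! j)) - d (idx (as ! j)) = 0"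
    using fs.independentD[OF ind, of "set as" "\<lambda>a. c (idx a) - d (idx a)" "as ! j"] j by simp
  then show ?thesis using idx j by simp
qed

text \<open>
  Substituting one expansion into the other expands \<open>as\<close> in itself with coefficient matrix
  \<open>T * S\<close>, and such an expansion is unique.
\<close>

lemma basis_change_inverse:
  fixes S T :: "'k::field mat"
  assumes as: "basis_list U as" and m: "length as = m" "length bs = m"
    and S: "S \<in> carrier_mat m m" "\<And>i. i < m \<Longrightarrow> bs ! i = (\<Sum>j<m. fscale (S $$ (i, j)) (as ! j))"
    and T: "T \<in> carrier_mat m m" "\<And>i. i < m \<Longrightarrow> as ! i = (\<Sum>j<m. fscale (T $$ (i, j)) (bs ! j))"
  shows "T * S = 1\<^sub>m m"
proof (rule eq_matI)
  fix i l assume il: "i < dim_row (1\<^sub>m m :: 'k mat)" "l < dim_col (1\<^sub>m m :: 'k mat)"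
  have prod: "(T * S) $$ (i, k) = (\<Sum>j<m. T $$ (i, j) * S $$ (j, k))" if "k < m" for k
    using il S(1) T(1) that by (simp add: scalar_prod_def atLeast0LessThan)
  have "(\<Sum>k<m. fscale ((T * S) $$ (i, k)) (as ! k)) =
      (\<Sum>k<m. \<Sum>j<m. fscale (T $$ (i, j)) (fscale (S $$ (j, k)) (as ! k)))"
    by (intro sum.cong refl) (simp add: prod fs.scale_sum_left)
  also have "\<dots> = (\<Sum>j<m. \<Sum>k<m. fscale (T $$ (i, j)) (fscale (S $$ (j, k)) (as ! k)))"
    by (rule sum.swap)
  also have "\<dots> = (\<Sum>j<m. fscale (T $$ (i, j)) (bs ! j))"
    by (simp add: S(2) fs.scale_sum_right)
  also have "\<dots> = as ! i"
    using T(2)[symmetric] il by simp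
  also have "\<dots> = (\<Sum>k<m. fscale (1\<^sub>m m $$ (i, k)) (as ! k))"
  proof -
    have "(\<Sum>k<m. fscale (1\<^sub>m m $$ (i, k)) (as ! k)) = (\<Sum>k<m. if k = i then as ! i else 0)"
      using il by (intro sum.cong refl) (auto simp: fun_eq_iff)
    then show ?thesis using il by simp
  qed
  finally show "(T * S) $$ (i, l) = 1\<^sub>m m $$ (i, l)"
    using basis_list_coeffs_unique[OF as, of "\<lambda>k. (T * S) $$ (i, k)" "\<lambda>k. 1\<^sub>m m $$ (i, k)" l] il m
    by simp
qed (use S(1) T(1) in auto)

lemma basis_change_matrix:
  assumes as: "basis_list U as" and bs: "basis_list U bs" and m: "length as = m" "length bs = m"
  obtains S where "S \<in> carrier_mat m m" "invertible_mat S"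
    "\<And>i. i < m \<Longrightarrow> bs ! i = (\<Sum>j<m. fscale (S $$ (i, j)) (as ! j))"
proof -
  have "\<exists>S. S \<in> carrier_mat m m \<and> (\<forall>i<m. ys ! i = (\<Sum>j<m. fscale (S $$ (i, j)) (xs ! j)))"
    if "basis_list U xs" "basis_list U ys" "length xs = m" "length ys = m" for xs ys
  proof -
    have "\<exists>c. ys ! i = (\<Sum>j<m. fscale (c j) (xs ! j))" if "i < m" for i
      using basis_list_expand[OF \<open>basis_list U xs\<close>, of "ys ! i"] basis_list_subset[OF \<open>basis_list U ys\<close>]
        \<open>length xs = m\<close> \<open>length ys = m\<close> \<open>i < m\<close> by (metis nth_mem subsetD)
    then obtain c where "\<forall>i<m. ys ! i = (\<Sum>j<m. fscale (c i j) (xs ! j))"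
      by metis
    then show ?thesis
      by (intro exI[of _ "mat m m (\<lambda>(i, j). c i j)"]) auto
  qed
  from this[OF as bs m] this[OF bs as m(2,1)] obtain S T
    where S: "S \<in> carrier_mat m m" "\<And>i. i < m \<Longrightarrow> bs ! i = (\<Sum>j<m. fscale (S $$ (i, j)) (as ! j))"
      and T: "T \<in> carrier_mat m m" "\<And>i. i < m \<Longrightarrow> as ! i = (\<Sum>j<m. fscale (T $$ (i, j)) (bs ! j))"
    by blast
  have "T * S = 1\<^sub>m m" "S * T = 1\<^sub>m m"
    using basis_change_inverse[OF as m S T] basis_change_inverse[OF bs m(2,1) T S] by auto
  then have "invertible_mat S"
    using S(1) T(1) unfolding invertible_mat_def inverts_mat_def by auto
  with S show ?thesis by (intro that)
qed

text \<open>
  The bridge to vector spaces with an explicit carrier.  Taking \<open>T\<close> to be the identity of the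
  dihedral algebra or the coordinate map \<^const>\<open>psi\<close> gives the bases that define generating
  matrices of dihedral and of cyclic codes.
\<close>

lemma basis_list_imp_basis:
  fixes V :: "('k::field, 'v, 'm) module_scheme" and T :: "('x \<Rightarrow> 'k) \<Rightarrow> 'v"
  assumes V: "vectorspace class_ring V" and bs: "basis_list U bs"
    and inj: "inj_on T U" and TV: "T ` U \<subseteq> carrier V"
    and add: "\<And>f g. f \<in> U \<Longrightarrow> g \<in> U \<Longrightarrow> T (f + g) = T f \<oplus>\<^bsub>V\<^esub> T g"
    and scale: "\<And>c f. f \<in> U \<Longrightarrow> T (fscale c f) = c \<odot>\<^bsub>V\<^esub> T f"
  shows "vectorspace.basis class_ring (V\<lparr>carrier := T ` U\<rparr>) (T ` set bs)"
proof -
  interpret V: vectorspace class_ring V by fact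
  note U = basis_list_subspace[OF bs]
  note bsU = basis_list_subset[OF bs]
  have carr: "carrier (class_ring :: 'k ring) = UNIV" "\<zero>\<^bsub>class_ring :: 'k ring\<^esub> = 0"
    by (auto simp: class_ring_simps)
  have T0: "T 0 = \<zero>\<^bsub>V\<^esub>"
  proof -
    have "T 0 = 0 \<odot>\<^bsub>V\<^esub> T 0"
      using scale[of 0 0] fs.subspace_0[OF U] by (simp add: fun_eq_iff)
    also have "\<dots> = \<zero>\<^bsub>V\<^esub>"
      using V.lmult_0[of "T 0"] TV fs.subspace_0[OF U] by (auto simp: class_ring_simps)
    finally show ?thesis .
  qed
  have sub: "subspace class_ring (T ` U) V"
    unfolding subspace_def submodule_def
  proof (intro conjI allI impI)
    show "vectorspace class_ring V" by fact
    show "T ` U \<subseteq> carrier V" by fact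
    show "\<zero>\<^bsub>V\<^esub> \<in> T ` U"
      using T0 fs.subspace_0[OF U] by force
    show "v \<oplus>\<^bsub>V\<^esub> w \<in> T ` U" if "v \<in> T ` U" "w \<in> T ` U" for v w
      using that fs.subspace_add[OF U] by (auto simp flip: add)
    show "c \<odot>\<^bsub>V\<^esub> v \<in> T ` U" if "c \<in> carrier class_ring" "v \<in> T ` U" for c v
      using that fs.subspace_scale[OF U] by (auto simp flip: scale)
  qed (rule V.module_axioms)
  have lc: "V.lincomb a (T ` S) = T (\<Sum>s\<in>S. fscale (a (T s)) s)" if "finite S" "S \<subseteq> U" for a S
    using that
  proof (induction S)
    case empty
    then show ?case using T0 by (simp add: V.lincomb_def zero_fun_def)
  next
    case (insert s S)
    let ?g = "\<lambda>s. fscale (a (T s)) s"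
    have U': "?g s \<in> U" "sum ?g S \<in> U"
      using insert.prems by (intro fs.subspace_sum[OF U] fs.subspace_scale[OF U]; blast)+
    have "T s \<notin> T ` S"
      using insert.hyps(2) insert.prems inj_on_image_mem_iff[OF inj, of s S] by blast
    then have "V.lincomb a (T ` S \<union> {T s}) = a (T s) \<odot>\<^bsub>V\<^esub> T s \<oplus>\<^bsub>V\<^esub> V.lincomb a (T ` S)"
      using insert.hyps(1) insert.prems TV by (intro V.lincomb_insert) (auto simp only: carr finite_imageI)
    also have "\<dots> = T (?g s) \<oplus>\<^bsub>V\<^esub> T (sum ?g S)"
      using insert.prems insert.IH scale[of s "a (T s)"] by (simp only: insert_subset)
    also have "\<dots> = T (?g s + sum ?g S)"
      by (rule add[OF U', symmetric])
    also have "?g s + sum ?g S = sum ?g (insert s S)"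
      by (rule sum.insert[OF insert.hyps, symmetric])
    finally show ?case by (simp only: image_insert Un_insert_right Un_empty_right)
  qed
  have li: "\<not> V.lin_dep (T ` set bs)"
  proof (rule V.finite_lin_indpt2)
    fix a assume "V.lincomb a (T ` set bs) = \<zero>\<^bsub>V\<^esub>"
    then have "T (\<Sum>s\<in>set bs. fscale (a (T s)) s) = T 0"
      by (simp add: lc bsU T0)
    then have "(\<Sum>s\<in>set bs. fscale (a (T s)) s) = 0"
      using bsU U by (intro inj_onD[OF inj] fs.subspace_sum fs.subspace_scale fs.subspace_0) auto
    then show "\<forall>v\<in>T ` set bs. a v = \<zero>\<^bsub>class_ring\<^esub>"
      using fs.independentD[of "set bs" "set bs" "\<lambda>s. a (T s)"] bs
      by (auto simp: basis_list_def carr)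
  qed (use bsU TV in auto)
  have span: "V.span (T ` set bs) = T ` U"
  proof -
    have "V.span (T ` set bs) = {V.lincomb a (T ` set bs) |a. True}"
      using bsU TV by (subst V.finite_span) (auto simp: carr)
    also have "\<dots> = T ` {\<Sum>s\<in>set bs. fscale (a (T s)) s |a. True}"
      by (auto simp: lc bsU)
    also have "{\<Sum>s\<in>set bs. fscale (a (T s)) s |a. True} = U"
    proof
      show "{\<Sum>s\<in>set bs. fscale (a (T s)) s |a. True} \<subseteq> U"
        using bsU U by (auto intro!: fs.subspace_sum fs.subspace_scale)
      show "U \<subseteq> {\<Sum>s\<in>set bs. fscale (a (T s)) s |a. True}"
      proof
        fix u assume "u \<in> U"
        then obtain c where c: "u = (\<Sum>s\<in>set bs. fscale (c s) s)"
          using bs fs.span_finite[of "set bs"] by (auto simp: basis_list_def)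
        \<comment> \<open>In \<open>V\<close> the coefficients are indexed by the images \<open>T s\<close> instead of by \<open>s\<close>.\<close>
        have "(\<Sum>s\<in>set bs. fscale (c s) s) =
            (\<Sum>s\<in>set bs. fscale ((c \<circ> the_inv_into U T) (T s)) s)"
          using bsU by (intro sum.cong refl) (auto simp: the_inv_into_f_f[OF inj])
        with c show "u \<in> {\<Sum>s\<in>set bs. fscale (a (T s)) s |a. True}" by blast
      qed
    qed
    finally show ?thesis .
  qed
  interpret W: vectorspace class_ring "V\<lparr>carrier := T ` U\<rparr>"
    by (rule V.subspace_is_vs[OF sub])
  have subm: "submodule class_ring (T ` U) V"
    using sub by (simp add: subspace_def)
  have "T ` set bs \<subseteq> T ` U" using bsU by blast
  then show ?thesis
    unfolding W.basis_def using V.span_li_not_depend[OF _ subm, of "T ` set bs"] li span by simp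
qed

section \<open>Left ideals of group algebras\<close>

text \<open>
  Left multiplication by the group element \<open>g\<close>, written without a sum.  A left ideal is then a
  subspace that is stable under these linear maps.
\<close>

definition translate :: "('g, 'm) monoid_scheme \<Rightarrow> 'g \<Rightarrow> ('g \<Rightarrow> 'k::field) \<Rightarrow> 'g \<Rightarrow> 'k" where
  "translate G g f = (\<lambda>x. if x \<in> carrier G then f (inv\<^bsub>G\<^esub> g \<otimes>\<^bsub>G\<^esub> x) else 0)"

definition invariant_subspace :: "('g, 'm) monoid_scheme \<Rightarrow> ('g \<Rightarrow> 'k::field) set \<Rightarrow> bool" where
  "invariant_subspace G I \<longleftrightarrow> fs.subspace I \<and> I \<subseteq> carrier (group_algebra G) \<and>
     (\<forall>g\<in>carrier G. \<forall>f\<in>I. translate G g f \<in> I)"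

lemma flinear_translate: "flinear (translate G g)"
  by (rule flinearI) (auto simp: translate_def fun_eq_iff)

lemma translate_closed: "translate G g f \<in> carrier (group_algebra G)"
  by (simp add: translate_def)

lemma translate_mult:
  assumes "group G" "g \<in> carrier G" "h \<in> carrier G"
  shows "translate G (g \<otimes>\<^bsub>G\<^esub> h) f = translate G g (translate G h f)"
proof -
  interpret group G by fact
  show ?thesis
    using assms by (auto simp: translate_def fun_eq_iff inv_mult_group m_assoc)
qed

lemma translate_one:
  assumes "group G" "f \<in> carrier (group_algebra G)"
  shows "translate G \<one>\<^bsub>G\<^esub> f = f"
proof -
  interpret group G by fact
  show ?thesis
    using assms(2) by (auto simp: translate_def fun_eq_iff)
qed

lemma translate_inverse:
  assumes "group G" "g \<in> carrier G" "f \<in> carrier (group_algebra G)"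
  shows "translate G (inv\<^bsub>G\<^esub> g) (translate G g f) = f"
proof -
  interpret group G by fact
  show ?thesis
    using assms translate_mult[OF assms(1), of "inv\<^bsub>G\<^esub> g" g f] translate_one[OF assms(1,3)]
    by simp
qed

lemma group_algebra_mult_eq_sum_translate:
  assumes "group G" "finite (carrier G)"
  shows "r \<otimes>\<^bsub>group_algebra G\<^esub> f = (\<Sum>g\<in>carrier G. fscale (r g) (translate G g f))"
  by (rule ext) (simp add: group_algebra_mult[OF assms] sum_fun_apply translate_def)

lemma basis_elem_mult_eq_translate:
  assumes "group G" "finite (carrier G)" "g \<in> carrier G"
  shows "basis_elem g \<otimes>\<^bsub>group_algebra G\<^esub> f = translate G g f"
proof -
  have "basis_elem g \<otimes>\<^bsub>group_algebra G\<^esub> f =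
      (\<Sum>h\<in>carrier G. if h = g then translate G g f else 0)"
    unfolding group_algebra_mult_eq_sum_translate[OF assms(1,2)]
    by (intro sum.cong refl) (auto simp: basis_elem_def fun_eq_iff)
  then show ?thesis using assms by simp
qed

lemma left_ideal_iff_invariant_subspace:
  fixes I :: "('g \<Rightarrow> 'k::field) set"
  assumes G: "group G" "finite (carrier G)"
  shows "left_ideal I (group_algebra G) \<longleftrightarrow> invariant_subspace G I"
proof
  let ?A = "group_algebra G :: ('k, _) module"
  interpret A: ring ?A by (rule ring_group_algebra[OF G])
  assume I: "left_ideal I ?A"
  then interpret I: additive_subgroup I ?A by (simp add: left_ideal_def)
  have trans: "translate G g f \<in> I" if "g \<in> carrier G" "f \<in> I" for g f
  proof -
    have "basis_elem g \<in> carrier ?A" using that by (auto simp: basis_elem_def)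
    then have "basis_elem g \<otimes>\<^bsub>?A\<^esub> f \<in> I"
      using I that unfolding left_ideal_def by blast
    then show ?thesis by (simp add: basis_elem_mult_eq_translate[OF G that(1)])
  qed
  have one: "\<one>\<^bsub>G\<^esub> \<in> carrier G" using G(1) by (simp add: group.is_monoid monoid.one_closed)
  have "fscale c f \<in> I" if f: "f \<in> I" for c f
  proof -
    \<comment> \<open>Multiplication by the scalar \<open>c\<close> is multiplication by the algebra element \<open>c \<sqdot> 1\<close>.\<close>
    have "fscale c (basis_elem \<one>\<^bsub>G\<^esub>) \<otimes>\<^bsub>?A\<^esub> f = fscale c (basis_elem \<one>\<^bsub>G\<^esub> \<otimes>\<^bsub>?A\<^esub> f)"
      by (simp add: group_algebra_mult_eq_sum_translate[OF G] fs.scale_sum_right)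
    also have "\<dots> = fscale c f"
      using f I.a_subset G
      by (subst basis_elem_mult_eq_translate[OF G one], subst translate_one) blast+
    finally have eq: "fscale c (basis_elem \<one>\<^bsub>G\<^esub>) \<otimes>\<^bsub>?A\<^esub> f = fscale c f" .
    have "fscale c (basis_elem \<one>\<^bsub>G\<^esub>) \<in> carrier ?A"
      using one by (auto simp: basis_elem_def)
    then have "fscale c (basis_elem \<one>\<^bsub>G\<^esub>) \<otimes>\<^bsub>?A\<^esub> f \<in> I"
      using I f unfolding left_ideal_def by blast
    then show ?thesis by (simp only: eq)
  qed
  moreover have "0 \<in> I"
    using I.zero_closed by (simp add: zero_fun_def)
  moreover have "f + g \<in> I" if "f \<in> I" "g \<in> I" for f g
    using I.a_closed[OF that] by (simp add: plus_fun_def)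
  ultimately have "fs.subspace I" by (simp add: fs.subspace_def)
  then show "invariant_subspace G I"
    using trans I.a_subset by (auto simp: invariant_subspace_def simp del: group_algebra_simps)
next
  let ?A = "group_algebra G :: ('k, _) module"
  interpret A: ring ?A by (rule ring_group_algebra[OF G])
  assume I: "invariant_subspace G I"
  then have sub: "fs.subspace I" and IA: "I \<subseteq> carrier ?A"
    by (simp_all add: invariant_subspace_def del: group_algebra_simps)
  have "subgroup I (add_monoid ?A)"
  proof (rule A.add.subgroupI)
    show "I \<subseteq> carrier ?A" by fact
    show "I \<noteq> {}" using fs.subspace_0[OF sub] by blast
    show "\<ominus>\<^bsub>?A\<^esub> f \<in> I" if f: "f \<in> I" for f
    proof -
      have "- f \<in> I" "f \<in> carrier ?A" "- f \<in> carrier ?A"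
        using fs.subspace_neg[OF sub f] f IA by blast+
      moreover have "- f \<oplus>\<^bsub>?A\<^esub> f = \<zero>\<^bsub>?A\<^esub>"
        by auto
      ultimately have "\<ominus>\<^bsub>?A\<^esub> f = - f"
        using A.minus_equality by blast
      with \<open>- f \<in> I\<close> show ?thesis by simp
    qed
    show "f \<oplus>\<^bsub>?A\<^esub> g \<in> I" if "f \<in> I" "g \<in> I" for f g
      using fs.subspace_add[OF sub that] by (simp add: plus_fun_def)
  qed
  then have "additive_subgroup I ?A" by (rule additive_subgroupI)
  moreover have "r \<otimes>\<^bsub>?A\<^esub> f \<in> I" if "f \<in> I" for r f
    unfolding group_algebra_mult_eq_sum_translate[OF G]
    using I that by (intro fs.subspace_sum[OF sub] fs.subspace_scale[OF sub])
      (auto simp: invariant_subspace_def)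
  ultimately show "left_ideal I ?A" by (simp add: left_ideal_def)
qed

text \<open>The algebra of a commutative group is commutative, so one-sided ideals are two-sided.\<close>

lemma ideal_of_comm_group_algebra:
  fixes I :: "('g \<Rightarrow> 'k::field) set"
  assumes G: "comm_group G" "finite (carrier G)" and I: "invariant_subspace G I"
  shows "ideal I (group_algebra G)"
proof -
  let ?A = "group_algebra G :: ('k, _) module"
  interpret G: comm_group G by fact
  interpret A: ring ?A by (rule ring_group_algebra[OF G.is_group G(2)])
  have comm: "f \<otimes>\<^bsub>?A\<^esub> g = g \<otimes>\<^bsub>?A\<^esub> f" for f g
    unfolding group_algebra_def by (rule ext, simp, subst sum.swap)
      (intro sum.cong refl, simp add: G.m_comm mult.commute)
  have "left_ideal I ?A"
    using I by (simp only: left_ideal_iff_invariant_subspace[OF G.is_group G(2)])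
  then show ?thesis
    unfolding left_ideal_def
    by (intro idealI A.ring_axioms)
      (auto simp: additive_subgroup_def simp del: group_algebra_simps, subst comm, blast)
qed

lemma finite_group_algebra:
  assumes "finite (carrier G)"
  shows "finite (carrier (group_algebra G :: ('k::{field, finite}, _) module))"
proof -
  have "carrier (group_algebra G :: ('k, _) module) =
      {f. \<forall>x. (x \<in> carrier G \<longrightarrow> f x \<in> UNIV) \<and> (x \<notin> carrier G \<longrightarrow> f x = 0)}"
    by simp
  then show ?thesis
    using finite_set_of_finite_funs[OF assms, of "UNIV :: 'k set" 0] by simp
qed

text \<open>
  Maschke's theorem.  Averaging a linear projection of the whole space onto \<open>D\<close> over the group
  gives a projection \<open>P\<close> that commutes with translations, so the kernel of \<open>P\<close> in \<open>E\<close> is an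
  invariant complement.
\<close>

theorem invariant_complement:
  fixes D E :: "('g \<Rightarrow> 'k::field) set"
  assumes G: "group G" "finite (carrier G)" and char: "(of_nat (card (carrier G)) :: 'k) \<noteq> 0"
    and D: "invariant_subspace G D" and E: "invariant_subspace G E" and DE: "D \<subseteq> E"
  obtains M where "invariant_subspace G M" "M \<subseteq> E" "D \<inter> M = {0}"
    "\<forall>e\<in>E. \<exists>d\<in>D. \<exists>m\<in>M. e = d + m"
proof -
  interpret G: group G by fact
  have subD: "fs.subspace D" and subE: "fs.subspace E"
    using D E by (simp_all add: invariant_subspace_def)
  obtain p :: "('g \<Rightarrow> 'k) \<Rightarrow> ('g \<Rightarrow> 'k)"
    where p: "range p \<subseteq> D" "flinear p" "\<And>d. d \<in> D \<Longrightarrow> p d = d"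
    using fsp.linear_exists_left_inverse_on[OF fs.linear_id subD] by auto
  interpret p: Vector_Spaces.linear fscale fscale p by fact
  interpret t: Vector_Spaces.linear fscale fscale "translate G g :: ('g \<Rightarrow> 'k) \<Rightarrow> _" for g
    by (rule flinear_translate)
  define P where "P f = fscale (1 / of_nat (card (carrier G)))
    (\<Sum>g\<in>carrier G. translate G (inv\<^bsub>G\<^esub> g) (p (translate G g f)))" for f
  have "flinear P"
    by (rule flinearI)
      (simp_all add: P_def t.add t.scale p.add p.scale sum.distrib fs.scale_right_distrib
        fs.scale_sum_right mult.commute)
  then interpret P: Vector_Spaces.linear fscale fscale P .
  have pD: "p f \<in> D" for f
    using p(1) by blast
  have PD: "P f \<in> D" for f
    unfolding P_def using D pD
    by (intro fs.subspace_scale[OF subD] fs.subspace_sum[OF subD])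
      (auto simp: invariant_subspace_def)
  have Pd: "P d = d" if "d \<in> D" for d
  proof -
    have "translate G (inv\<^bsub>G\<^esub> g) (p (translate G g d)) = d" if "g \<in> carrier G" for g
      using D p(3) \<open>d \<in> D\<close> that translate_inverse[OF G(1) that, of d]
      by (auto simp: invariant_subspace_def)
    then have "P d = fscale (1 / of_nat (card (carrier G))) (\<Sum>g\<in>carrier G. d)"
      unfolding P_def by simp
    then show ?thesis
      using char by (simp add: fun_eq_iff sum_fun_apply)
  qed
  have Pt: "P (translate G h f) = translate G h (P f)" if h: "h \<in> carrier G" for h f
  proof -
    have "(\<Sum>g\<in>carrier G. translate G (inv\<^bsub>G\<^esub> g) (p (translate G g (translate G h f)))) =
        (\<Sum>g\<in>carrier G. translate G h (translate G (inv\<^bsub>G\<^esub> g) (p (translate G g f))))"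
    proof (rule sum.reindex_bij_witness[of _ "\<lambda>g. g \<otimes>\<^bsub>G\<^esub> inv\<^bsub>G\<^esub> h" "\<lambda>g. g \<otimes>\<^bsub>G\<^esub> h"])
      fix g assume g: "g \<in> carrier G"
      have "h \<otimes>\<^bsub>G\<^esub> inv\<^bsub>G\<^esub> (g \<otimes>\<^bsub>G\<^esub> h) = inv\<^bsub>G\<^esub> g"
        using g h by (simp add: G.inv_mult_group flip: G.m_assoc)
      then show "translate G h (translate G (inv\<^bsub>G\<^esub> (g \<otimes>\<^bsub>G\<^esub> h)) (p (translate G (g \<otimes>\<^bsub>G\<^esub> h) f))) =
          translate G (inv\<^bsub>G\<^esub> g) (p (translate G g (translate G h f)))"
        using g h
        by (simp add: translate_mult[OF G(1) g h] flip: translate_mult[OF G(1), of h "inv\<^bsub>G\<^esub> (g \<otimes>\<^bsub>G\<^esub> h)"])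
    qed (use h in \<open>simp_all add: G.m_assoc\<close>)
    then show ?thesis
      by (simp add: P_def t.scale t.sum)
  qed
  define M where "M = {f \<in> E. P f = 0}"
  show ?thesis
  proof
    show "invariant_subspace G M"
      using E by (auto simp: invariant_subspace_def M_def fs.subspace_def P.add P.scale P.zero Pt t.zero)
    show "M \<subseteq> E" by (auto simp: M_def)
    show "D \<inter> M = {0}"
      using Pd fs.subspace_0[OF subD] fs.subspace_0[OF subE] by (auto simp: M_def P.zero)
    show "\<forall>e\<in>E. \<exists>d\<in>D. \<exists>m\<in>M. e = d + m"
    proof (intro ballI bexI)
      fix e assume "e \<in> E"
      show "e = P e + (e - P e)" by simp
      show "e - P e \<in> M"
        using \<open>e \<in> E\<close> DE PD[of e] fs.subspace_diff[OF subE, of e "P e"]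
        by (auto simp: M_def P.diff Pd)
    qed (rule PD)
  qed
qed

text \<open>
  Otherwise both \<open>n\<close> and the cardinality of the field would vanish in the field, and so would
  their greatest common divisor \<open>1\<close>.
\<close>

lemma of_nat_nonzero_if_coprime_card:
  assumes "coprime CARD('k::{field, finite}) n"
  shows "(of_nat n :: 'k) \<noteq> 0"
proof
  assume n: "(of_nat n :: 'k) = 0"
  \<comment> \<open>Adding \<open>1\<close> permutes the field, so the sum of all elements does not change.\<close>
  have "(\<Sum>x\<in>(UNIV :: 'k set). x) = (\<Sum>x\<in>UNIV. x + 1)"
    by (rule sum.reindex_bij_witness[of _ "\<lambda>x. x + 1" "\<lambda>x. x - 1"]) auto
  then have card: "(of_nat CARD('k) :: 'k) = 0"
    by (simp add: sum.distrib)
  obtain u v where "u * int CARD('k) + v * int n = 1"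
    using assms bezout_int[of "int CARD('k)" "int n"] by (auto simp: coprime_iff_gcd_eq_1)
  then have "of_int (u * int CARD('k) + v * int n) = (1 :: 'k)"
    by simp
  then show False
    using n card by simp
qed

section \<open>Rotations and reflections\<close>

abbreviation rotation_group :: "nat \<Rightarrow> (bool \<times> nat) monoid" where
  "rotation_group n \<equiv> (dihedral n)\<lparr>carrier := rotations n\<rparr>"

text \<open>
  As \<open>b (P + b Q) = Q + b P\<close>, this map swaps the two components of an element.
\<close>

definition reflect :: "nat \<Rightarrow> (bool \<times> nat \<Rightarrow> 'k::field) \<Rightarrow> bool \<times> nat \<Rightarrow> 'k" where
  "reflect n = translate (dihedral n) gen_b"

text \<open>
  The elements \<open>P + b Q\<close> with \<open>P\<close> and \<open>Q\<close> in \<open>J\<close>, that is \<open>J + b J\<close>, described by the two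
  components so that membership is a condition on projections.
\<close>

definition induced :: "nat \<Rightarrow> (bool \<times> nat \<Rightarrow> 'k::field) set \<Rightarrow> (bool \<times> nat \<Rightarrow> 'k) set" where
  "induced n J = {f \<in> carrier (dihedral_algebra n). pr_a n f \<in> J \<and> pr_a n (reflect n f) \<in> J}"

lemma inv_dihedral:
  assumes "2 \<le> n" "i < n"
  shows "inv\<^bsub>dihedral n\<^esub> (False, i) = (False, (n - i) mod n)" "inv\<^bsub>dihedral n\<^esub> (True, i) = (True, i)"
proof -
  interpret group "dihedral n" using assms by (intro group_dihedral) auto
  show "inv\<^bsub>dihedral n\<^esub> (False, i) = (False, (n - i) mod n)"
    by (rule inv_equality) (use assms in \<open>auto simp: mod_simps\<close>)
  show "inv\<^bsub>dihedral n\<^esub> (True, i) = (True, i)"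
    by (rule inv_equality) (use assms in auto)
qed

lemma reflect_apply:
  assumes "2 \<le> n"
  shows "reflect n f (s, j) = (if j < n then f (\<not> s, j) else 0)"
  using assms by (auto simp: reflect_def translate_def gen_b_def inv_dihedral)

lemma pr_a_apply:
  assumes "2 \<le> n"
  shows "pr_a n f (s, j) = (if \<not> s \<and> j < n then f (s, j) else 0)"
  using assms by (auto simp: pr_a_def rotations_eq)

lemma carrier_dihedral_algebra:
  "f \<in> carrier (dihedral_algebra n) \<longleftrightarrow> (\<forall>s j. \<not> j < n \<longrightarrow> f (s, j) = 0)"
  by (auto simp: dihedral_algebra_def)

lemma carrier_cyclic_algebra:
  assumes "2 \<le> n"
  shows "f \<in> carrier (cyclic_algebra n) \<longleftrightarrow> (\<forall>s j. s \<or> \<not> j < n \<longrightarrow> f (s, j) = 0)"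
  using assms by (auto simp: cyclic_algebra_def rotations_eq)

lemma flinear_reflect: "flinear (reflect n)"
  unfolding reflect_def by (rule flinear_translate)

lemma flinear_pr_a: "flinear (pr_a n)"
  by (rule flinearI) (auto simp: pr_a_def fun_eq_iff)

lemma cyclic_subset_dihedral_algebra:
  assumes "2 \<le> n"
  shows "carrier (cyclic_algebra n) \<subseteq> carrier (dihedral_algebra n)"
  using assms by (auto simp: carrier_cyclic_algebra carrier_dihedral_algebra)

lemma pr_a_closed: "2 \<le> n \<Longrightarrow> pr_a n f \<in> carrier (cyclic_algebra n)"
  by (simp add: carrier_cyclic_algebra pr_a_apply)

lemma pr_a_cyclic: "2 \<le> n \<Longrightarrow> f \<in> carrier (cyclic_algebra n) \<Longrightarrow> pr_a n f = f"
  by (auto simp: carrier_cyclic_algebra pr_a_apply fun_eq_iff)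

lemma pr_a_reflect_cyclic: "2 \<le> n \<Longrightarrow> f \<in> carrier (cyclic_algebra n) \<Longrightarrow> pr_a n (reflect n f) = 0"
  by (auto simp: carrier_cyclic_algebra pr_a_apply reflect_apply fun_eq_iff)

lemma reflect_closed: "2 \<le> n \<Longrightarrow> reflect n f \<in> carrier (dihedral_algebra n)"
  by (simp add: carrier_dihedral_algebra reflect_apply)

lemma reflect_reflect: "2 \<le> n \<Longrightarrow> f \<in> carrier (dihedral_algebra n) \<Longrightarrow> reflect n (reflect n f) = f"
  by (auto simp: carrier_dihedral_algebra reflect_apply fun_eq_iff)

lemma dihedral_decomposition:
  assumes "2 \<le> n" "f \<in> carrier (dihedral_algebra n)"
  shows "f = pr_a n f + reflect n (pr_a n (reflect n f))"
  using assms by (auto simp: carrier_dihedral_algebra reflect_apply pr_a_apply fun_eq_iff)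

lemma inj_on_reflect:
  assumes "2 \<le> n"
  shows "inj_on (reflect n) (carrier (dihedral_algebra n))"
  by (rule inj_on_inverseI[of _ "reflect n"]) (rule reflect_reflect[OF assms])

lemma subgroup_rotations:
  assumes "2 \<le> n"
  shows "subgroup (rotations n) (dihedral n)"
proof -
  interpret group "dihedral n" using assms by (intro group_dihedral) auto
  show ?thesis
    unfolding rotations_def using assms by (intro generate_is_subgroup) (auto simp: gen_a_def)
qed

lemma comm_group_rotations:
  assumes "2 \<le> n"
  shows "comm_group (rotation_group n)"
proof -
  interpret group "dihedral n" using assms by (intro group_dihedral) auto
  interpret H: group "rotation_group n"
    by (rule subgroup_imp_group[OF subgroup_rotations[OF assms]])
  show ?thesis
    by (rule H.group_comm_groupI) (use assms in \<open>auto simp: rotations_eq add.commute\<close>)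
qed

text \<open>
  On functions supported on the rotations, the rotation group and the dihedral group act alike;
  this lets ideals of the cyclic algebra be tested with dihedral translations.
\<close>

lemma translate_rotation_group:
  assumes "2 \<le> n" "h \<in> rotations n" "f \<in> carrier (cyclic_algebra n)"
  shows "translate (rotation_group n) h f = translate (dihedral n) h f"
proof -
  interpret group "dihedral n" using assms by (intro group_dihedral) auto
  obtain i where h: "h = (False, i)" "i < n" using assms by (auto simp: rotations_eq)
  have "inv\<^bsub>rotation_group n\<^esub> h = inv\<^bsub>dihedral n\<^esub> h"
    by (rule m_inv_consistent[OF subgroup_rotations[OF assms(1)] assms(2)])
  then show ?thesis
    using assms h by (auto simp: translate_def fun_eq_iff rotations_eq inv_dihedral carrier_cyclic_algebra)
qed

text \<open>Left multiplication by a rotation preserves each of the two cosets of the rotation group.\<close>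

lemma pr_a_translate:
  assumes "2 \<le> n" "h \<in> rotations n"
  shows "pr_a n (translate (dihedral n) h f) = translate (dihedral n) h (pr_a n f)"
  using assms by (auto simp: translate_def fun_eq_iff pr_a_apply rotations_eq inv_dihedral)

text \<open>The relation \<open>b a\<^sup>i = a\<^sup>-\<^sup>i b\<close>, read as an identity between translations.\<close>

lemma reflect_translate:
  assumes "2 \<le> n" "h \<in> rotations n"
  shows "reflect n (translate (dihedral n) h f) = translate (dihedral n) (inv\<^bsub>dihedral n\<^esub> h) (reflect n f)"
proof -
  have G: "group (dihedral n)" using assms by (intro group_dihedral) auto
  then interpret group "dihedral n" .
  obtain i where h: "h = (False, i)" "i < n" using assms by (auto simp: rotations_eq)
  have b: "gen_b \<in> carrier (dihedral n)" using assms by (auto simp: gen_b_def)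
  have hc: "h \<in> carrier (dihedral n)" using h by auto
  have "gen_b \<otimes>\<^bsub>dihedral n\<^esub> h = inv\<^bsub>dihedral n\<^esub> h \<otimes>\<^bsub>dihedral n\<^esub> gen_b"
    using h assms by (cases "i = 0") (auto simp: gen_b_def inv_dihedral)
  then show ?thesis
    unfolding reflect_def
    by (simp only: translate_mult[OF G b hc, symmetric] translate_mult[OF G inv_closed[OF hc] b, symmetric])
qed

text \<open>Every element of the dihedral group is a rotation or \<open>b\<close> times a rotation.\<close>

lemma invariant_dihedral_iff:
  assumes "2 \<le> n"
  shows "invariant_subspace (dihedral n) I \<longleftrightarrow>
    fs.subspace I \<and> I \<subseteq> carrier (dihedral_algebra n) \<and> (\<forall>f\<in>I. reflect n f \<in> I) \<and>
    (\<forall>h\<in>rotations n. \<forall>f\<in>I. translate (dihedral n) h f \<in> I)"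
    (is "?L \<longleftrightarrow> ?R")
proof
  have "gen_b \<in> carrier (dihedral n)" "rotations n \<subseteq> carrier (dihedral n)"
    using assms by (auto simp: gen_b_def rotations_eq)
  then show "?L \<Longrightarrow> ?R"
    unfolding invariant_subspace_def reflect_def dihedral_algebra_def by blast
  assume R: ?R
  have "translate (dihedral n) g f \<in> I" if g: "g \<in> carrier (dihedral n)" and f: "f \<in> I" for g f
  proof -
    obtain s i where si: "g = (s, i)" "i < n" using g by auto
    have rot: "(False, i) \<in> rotations n" using si assms by (simp add: rotations_eq)
    show ?thesis
    proof (cases s)
      case False
      then show ?thesis using R rot f si by simp
    next
      case True
      have G: "group (dihedral n)" using assms by (intro group_dihedral) auto
      have "g = gen_b \<otimes>\<^bsub>dihedral n\<^esub> (False, i)"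
        using True si by (simp add: gen_b_def)
      moreover have "gen_b \<in> carrier (dihedral n)" "(False, i) \<in> carrier (dihedral n)"
        using si by (auto simp: gen_b_def)
      ultimately have "translate (dihedral n) g f = reflect n (translate (dihedral n) (False, i) f)"
        by (simp only: translate_mult[OF G] reflect_def)
      then show ?thesis using R rot f by simp
    qed
  qed
  then show ?L
    using R by (simp add: invariant_subspace_def dihedral_algebra_def del: group_algebra_simps)
qed

lemma invariant_rotation_group_iff:
  assumes "2 \<le> n"
  shows "invariant_subspace (rotation_group n) J \<longleftrightarrow>
    fs.subspace J \<and> J \<subseteq> carrier (cyclic_algebra n) \<and>
    (\<forall>h\<in>rotations n. \<forall>f\<in>J. translate (dihedral n) h f \<in> J)"
proof -
  have "translate (rotation_group n) h f = translate (dihedral n) h f"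
    if "J \<subseteq> carrier (cyclic_algebra n)" "h \<in> rotations n" "f \<in> J" for h f
    using translate_rotation_group[OF assms] that by blast
  then show ?thesis
    by (auto simp: invariant_subspace_def simp flip: cyclic_algebra_def simp del: group_algebra_simps)
qed

lemma dihedral_code_iff:
  assumes "2 \<le> n"
  shows "dihedral_code n C \<longleftrightarrow> invariant_subspace (dihedral n) C"
  unfolding dihedral_code_def dihedral_algebra_def
  using assms by (intro left_ideal_iff_invariant_subspace group_dihedral) auto

section \<open>Induced codes\<close>

lemma induced_eq_sum:
  assumes n: "2 \<le> n" and J: "J \<subseteq> carrier (cyclic_algebra n)" "fs.subspace J"
  shows "induced n J = {x + y |x y. x \<in> J \<and> y \<in> reflect n ` J}"
proof
  show "induced n J \<subseteq> {x + y |x y. x \<in> J \<and> y \<in> reflect n ` J}"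
    using dihedral_decomposition[OF n] by (fastforce simp: induced_def)
  interpret p: Vector_Spaces.linear fscale fscale "pr_a n :: (_ \<Rightarrow> 'a) \<Rightarrow> _" by (rule flinear_pr_a)
  interpret r: Vector_Spaces.linear fscale fscale "reflect n :: (_ \<Rightarrow> 'a) \<Rightarrow> _" by (rule flinear_reflect)
  have "x + reflect n y \<in> induced n J" if xy: "x \<in> J" "y \<in> J" for x y
  proof -
    have c: "x \<in> carrier (cyclic_algebra n)" "y \<in> carrier (cyclic_algebra n)"
      "x \<in> carrier (dihedral_algebra n)" "y \<in> carrier (dihedral_algebra n)"
      using xy J(1) cyclic_subset_dihedral_algebra[OF n] by blast+
    have "x + reflect n y \<in> carrier (dihedral_algebra n)"
      using c(3) n by (simp add: carrier_dihedral_algebra reflect_apply)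
    then show ?thesis
      using c xy
      by (simp add: induced_def p.add r.add pr_a_cyclic[OF n] pr_a_reflect_cyclic[OF n] reflect_reflect[OF n])
  qed
  then show "{x + y |x y. x \<in> J \<and> y \<in> reflect n ` J} \<subseteq> induced n J"
    by blast
qed

text \<open>
  A rotation \<open>h\<close> acts on the first component as \<open>h\<close> and on the second as \<open>h\<^sup>-\<^sup>1\<close>, and \<open>J\<close> is
  stable under both.
\<close>

lemma invariant_induced:
  assumes n: "2 \<le> n" and J: "invariant_subspace (rotation_group n) J"
  shows "invariant_subspace (dihedral n) (induced n J)"
proof -
  interpret group "dihedral n" using n by (intro group_dihedral) auto
  interpret p: Vector_Spaces.linear fscale fscale "pr_a n :: (_ \<Rightarrow> 'a) \<Rightarrow> _" by (rule flinear_pr_a)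
  interpret r: Vector_Spaces.linear fscale fscale "reflect n :: (_ \<Rightarrow> 'a) \<Rightarrow> _" by (rule flinear_reflect)
  note J' = J[unfolded invariant_rotation_group_iff[OF n]]
  have sub: "fs.subspace J" using J' by blast
  have "fs.subspace (induced n J)"
    using fs.subspace_0[OF sub] fs.subspace_add[OF sub] fs.subspace_scale[OF sub]
    by (auto simp: fs.subspace_def induced_def p.zero p.add p.scale r.zero r.add r.scale carrier_dihedral_algebra)
  moreover have "reflect n f \<in> induced n J" if "f \<in> induced n J" for f
    using that reflect_reflect[OF n, of f] reflect_closed[OF n, of f] by (simp add: induced_def)
  moreover have "translate (dihedral n) h f \<in> induced n J" if h: "h \<in> rotations n" and f: "f \<in> induced n J" for h f
  proof -
    have "inv\<^bsub>dihedral n\<^esub> h \<in> rotations n"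
      using subgroup_rotations[OF n] h by (rule subgroup.m_inv_closed)
    then show ?thesis
      using J' h f translate_closed[of "dihedral n" h f]
      by (simp add: induced_def pr_a_translate[OF n] reflect_translate[OF n] dihedral_algebra_def
          del: group_algebra_simps)
  qed
  moreover have "induced n J \<subseteq> carrier (dihedral_algebra n)"
    by (auto simp: induced_def)
  ultimately show ?thesis
    using n by (simp add: invariant_dihedral_iff)
qed

lemma left_ideal_generated_cyclic:
  assumes n: "2 \<le> n" and J: "invariant_subspace (rotation_group n) J"
  shows "left_ideal_generated (dihedral_algebra n) J = induced n J"
proof -
  have ideal: "left_ideal I (dihedral_algebra n) \<longleftrightarrow> invariant_subspace (dihedral n) I" for I :: "(bool \<times> nat \<Rightarrow> 'a) set"
    using dihedral_code_iff[OF n] by (simp add: dihedral_code_def)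
  have J': "J \<subseteq> carrier (cyclic_algebra n)" "fs.subspace J"
    using J by (simp_all add: invariant_rotation_group_iff[OF n])
  interpret r: Vector_Spaces.linear fscale fscale "reflect n :: (_ \<Rightarrow> 'a) \<Rightarrow> _" by (rule flinear_reflect)
  have "J \<subseteq> induced n J"
  proof
    fix f assume "f \<in> J"
    then have "\<exists>x y. f = x + y \<and> x \<in> J \<and> y \<in> reflect n ` J"
      using fs.subspace_0[OF J'(2)] by (intro exI[of _ f] exI[of _ 0]) (auto intro!: image_eqI[of _ _ 0] simp: r.zero)
    then show "f \<in> induced n J"
      by (auto simp: induced_eq_sum[OF n J'])
  qed
  moreover have "induced n J \<subseteq> I" if I: "invariant_subspace (dihedral n) I" "J \<subseteq> I" for I
  proof -
    have "x + reflect n y \<in> I" if "x \<in> J" "y \<in> J" for x y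
      using I that fs.subspace_add[of I x "reflect n y"] by (auto simp: invariant_dihedral_iff[OF n])
    then show ?thesis by (auto simp: induced_eq_sum[OF n J'])
  qed
  ultimately show ?thesis
    unfolding left_ideal_generated_def ideal using invariant_induced[OF n J] by blast
qed

text \<open>
  The two bases of \<open>J\<close> may differ: the two components of a code lead to different bases of the
  same ideal.
\<close>

lemma basis_list_induced:
  assumes n: "2 \<le> n" and J: "J \<subseteq> carrier (cyclic_algebra n)"
    and as: "basis_list J as" and bs: "basis_list J bs"
  shows "basis_list (induced n J) (as @ map (reflect n) bs)"
proof -
  interpret r: Vector_Spaces.linear fscale fscale "reflect n :: (_ \<Rightarrow> 'a) \<Rightarrow> _" by (rule flinear_reflect)
  interpret p: Vector_Spaces.linear fscale fscale "pr_a n :: (_ \<Rightarrow> 'a) \<Rightarrow> _" by (rule flinear_pr_a)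
  have JA: "J \<subseteq> carrier (dihedral_algebra n)"
    using J cyclic_subset_dihedral_algebra[OF n] by blast
  have 0: "0 \<in> J" by (rule fs.subspace_0[OF basis_list_subspace[OF as]])
  have "J \<inter> reflect n ` J = {0}"
  proof -
    have "x = 0" if "x \<in> J" "x = reflect n y" "y \<in> J" for x y
    proof -
      have "x = pr_a n x" using that J pr_a_cyclic[OF n, of x] by auto
      also have "\<dots> = 0" using that J pr_a_reflect_cyclic[OF n, of y] by auto
      finally show ?thesis .
    qed
    then show ?thesis using 0 r.zero by force
  qed
  then show ?thesis
    unfolding induced_eq_sum[OF n J basis_list_subspace[OF as]]
    by (intro basis_list_append as basis_list_map[OF bs] flinear_reflect
        inj_on_subset[OF inj_on_reflect[OF n] JA])
qed

section \<open>Decomposition of a dihedral code\<close>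

lemma invariant_cyclic_part:
  assumes n: "2 \<le> n" and C: "invariant_subspace (dihedral n) C"
  shows "invariant_subspace (rotation_group n) (C \<inter> carrier (cyclic_algebra n))"
proof -
  have "translate (dihedral n) h f \<in> carrier (cyclic_algebra n)"
    if "h \<in> rotations n" "f \<in> carrier (cyclic_algebra n)" for h and f :: "bool \<times> nat \<Rightarrow> 'a"
    using pr_a_closed[OF n, of "translate (dihedral n) h f"] pr_a_translate[OF n that(1), of f]
      pr_a_cyclic[OF n that(2)] by simp
  moreover have "fs.subspace (carrier (cyclic_algebra n :: ('a, _) module))"
    using n by (auto simp: fs.subspace_def carrier_cyclic_algebra)
  ultimately show ?thesis
    using C by (simp add: invariant_dihedral_iff[OF n] invariant_rotation_group_iff[OF n] fs.subspace_inter)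
qed

lemma invariant_projection:
  assumes n: "2 \<le> n" and C: "invariant_subspace (dihedral n) C"
  shows "invariant_subspace (rotation_group n) (pr_a n ` C)"
proof -
  interpret p: Vector_Spaces.linear fscale fscale "pr_a n :: (_ \<Rightarrow> 'a) \<Rightarrow> _" by (rule flinear_pr_a)
  show ?thesis
    using C p.subspace_image[of C]
    by (auto simp: invariant_dihedral_iff[OF n] invariant_rotation_group_iff[OF n] pr_a_closed[OF n]
        simp flip: pr_a_translate[OF n])
qed

text \<open>
  Here \<open>M\<close> is an invariant complement of \<open>C \<inter> R\<close> in \<open>pr C\<close>, where \<open>R\<close> is the cyclic algebra.
  Splitting both components of an element along this complement gives the sums.  The code is
  stable under swapping components, so \<open>N\<close> is too, and every statement about the second
  component follows from the one about the first.
\<close>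

theorem dihedral_code_decomposition:
  assumes n: "2 \<le> n" and C: "invariant_subspace (dihedral n) C"
    and M: "invariant_subspace (rotation_group n) M" "M \<subseteq> pr_a n ` C"
      "C \<inter> carrier (cyclic_algebra n) \<inter> M = {0}"
      "\<forall>e\<in>pr_a n ` C. \<exists>d\<in>C \<inter> carrier (cyclic_algebra n). \<exists>m\<in>M. e = d + m"
  defines "D \<equiv> C \<inter> carrier (cyclic_algebra n)" and "N \<equiv> C \<inter> induced n M"
  shows "induced n D \<inter> induced n M = {0}"
    and "C = {x + y |x y. x \<in> induced n D \<and> y \<in> N}"
    and "induced n (pr_a n ` C) = {x + y |x y. x \<in> induced n D \<and> y \<in> induced n M}"
    and "inj_on (pr_a n) N" "pr_a n ` N = M"
    and "inj_on (\<lambda>f. pr_a n (reflect n f)) N" "(\<lambda>f. pr_a n (reflect n f)) ` N = M"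
proof -
  interpret r: Vector_Spaces.linear fscale fscale "reflect n :: (_ \<Rightarrow> 'a) \<Rightarrow> _" by (rule flinear_reflect)
  interpret p: Vector_Spaces.linear fscale fscale "pr_a n :: (_ \<Rightarrow> 'a) \<Rightarrow> _" by (rule flinear_pr_a)
  note split_E = bspec[OF M(4)[folded D_def]]
  have D: "invariant_subspace (rotation_group n) D"
    unfolding D_def by (rule invariant_cyclic_part[OF n C])
  have E: "invariant_subspace (rotation_group n) (pr_a n ` C)"
    by (rule invariant_projection[OF n C])
  note C' = C[unfolded invariant_dihedral_iff[OF n]]
  note invariant' = invariant_rotation_group_iff[OF n, THEN iffD1]
  have subC: "fs.subspace C" and CA: "C \<subseteq> carrier (dihedral_algebra n)"
    using C' by blast+
  have refl: "reflect n f \<in> C" if "f \<in> C" for f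
    using C' that by blast
  have subD: "fs.subspace D" and subM: "fs.subspace M"
    using D M(1) by (blast dest: invariant')+
  have Dcyc: "D \<subseteq> carrier (cyclic_algebra n)" and Mcyc: "M \<subseteq> carrier (cyclic_algebra n)"
    using D M(1) by (blast dest: invariant')+
  note induced_M = invariant_induced[OF n M(1), unfolded invariant_dihedral_iff[OF n]]
  have 0: "0 \<in> induced n D" "0 \<in> induced n M"
    using fs.subspace_0[OF subD] fs.subspace_0[OF subM]
    by (auto simp: induced_def p.zero r.zero carrier_dihedral_algebra)
  have DM: "x = 0" if "x \<in> D" "x \<in> M" for x
    using M(3) that by (auto simp: D_def)
  have zero: "f = 0" if "f \<in> carrier (dihedral_algebra n)" "pr_a n f = 0" "pr_a n (reflect n f) = 0"
    for f :: "bool \<times> nat \<Rightarrow> 'a"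
    using dihedral_decomposition[OF n that(1)] that(2,3) by (simp add: r.zero)
  show "induced n D \<inter> induced n M = {0}"
  proof -
    have "f = 0" if "f \<in> induced n D" "f \<in> induced n M" for f
    proof (rule zero)
      show "pr_a n f = 0" "pr_a n (reflect n f) = 0"
        using that by (auto simp: induced_def intro: DM)
    qed (use that in \<open>simp add: induced_def\<close>)
    then show ?thesis using 0 by blast
  qed
  have DC: "induced n D \<subseteq> C"
    unfolding induced_eq_sum[OF n Dcyc subD]
    using fs.subspace_add[OF subC] refl by (auto simp: D_def)
  have split: "\<exists>x\<in>induced n D. \<exists>y\<in>induced n M. f = x + y"
    if f: "f \<in> induced n (pr_a n ` C)" for f
  proof -
    obtain d1 m1 where 1: "d1 \<in> D" "m1 \<in> M" "pr_a n f = d1 + m1"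
      using f split_E[of "pr_a n f"] by (auto simp: induced_def)
    obtain d2 m2 where 2: "d2 \<in> D" "m2 \<in> M" "pr_a n (reflect n f) = d2 + m2"
      using f split_E[of "pr_a n (reflect n f)"] by (auto simp: induced_def)
    have "f = d1 + m1 + reflect n (d2 + m2)"
      using dihedral_decomposition[OF n, of f] f 1(3) 2(3) by (simp add: induced_def)
    also have "\<dots> = (d1 + reflect n d2) + (m1 + reflect n m2)"
      by (simp add: r.add)
    finally have "f = (d1 + reflect n d2) + (m1 + reflect n m2)" .
    moreover have "d1 + reflect n d2 \<in> induced n D" "m1 + reflect n m2 \<in> induced n M"
      unfolding induced_eq_sum[OF n Dcyc subD] induced_eq_sum[OF n Mcyc subM]
      using 1 2 by blast+
    ultimately show ?thesis by blast
  qed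
  have CE: "C \<subseteq> induced n (pr_a n ` C)"
    using CA refl by (auto simp: induced_def)
  show "C = {x + y |x y. x \<in> induced n D \<and> y \<in> N}"
  proof
    show "{x + y |x y. x \<in> induced n D \<and> y \<in> N} \<subseteq> C"
      using DC fs.subspace_add[OF subC] by (auto simp: N_def)
    show "C \<subseteq> {x + y |x y. x \<in> induced n D \<and> y \<in> N}"
    proof
      fix f assume f: "f \<in> C"
      then obtain x y where xy: "x \<in> induced n D" "y \<in> induced n M" "f = x + y"
        using CE split by blast
      have "f - x \<in> C"
        by (rule fs.subspace_diff[OF subC]) (use f xy(1) DC in blast)+
      then have "y \<in> C" by (simp add: xy(3))
      with xy show "f \<in> {x + y |x y. x \<in> induced n D \<and> y \<in> N}"
        by (auto simp: N_def)
    qed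
  qed
  have DE: "D \<subseteq> pr_a n ` C"
    using pr_a_cyclic[OF n] by (force simp: D_def)
  show "induced n (pr_a n ` C) = {x + y |x y. x \<in> induced n D \<and> y \<in> induced n M}"
  proof
    show "{x + y |x y. x \<in> induced n D \<and> y \<in> induced n M} \<subseteq> induced n (pr_a n ` C)"
    proof -
      have "induced n D \<subseteq> induced n (pr_a n ` C)" "induced n M \<subseteq> induced n (pr_a n ` C)"
        using DE M(2) by (auto simp: induced_def)
      moreover have "fs.subspace (induced n (pr_a n ` C))"
        using invariant_induced[OF n E] by (simp add: invariant_subspace_def)
      ultimately show ?thesis
        by (blast intro: fs.subspace_add)
    qed
  qed (use split in blast)
  have subN: "fs.subspace N"
    unfolding N_def using subC induced_M by (blast intro: fs.subspace_inter)
  have reflN: "reflect n f \<in> N" if "f \<in> N" for f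
    using that refl induced_M by (auto simp: N_def)
  have NA: "N \<subseteq> carrier (dihedral_algebra n)"
    using CA by (auto simp: N_def)
  \<comment> \<open>If the first component vanishes, \<open>b f\<close> is the second one, which lies in \<open>D\<close> and in \<open>M\<close>.\<close>
  have kernel: "f = 0" if f: "f \<in> N" "pr_a n f = 0" for f
  proof -
    have fA: "f \<in> carrier (dihedral_algebra n)" using f NA by blast
    have "pr_a n (reflect n f) \<in> carrier (dihedral_algebra n)"
      using pr_a_closed[OF n] cyclic_subset_dihedral_algebra[OF n] by blast
    then have "reflect n (reflect n (pr_a n (reflect n f))) = pr_a n (reflect n f)"
      by (rule reflect_reflect[OF n])
    moreover have "reflect n (pr_a n (reflect n f)) = f"
      using dihedral_decomposition[OF n fA] f(2) by simp
    ultimately have "reflect n f = pr_a n (reflect n f)"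
      by (simp only:)
    moreover have "pr_a n (reflect n f) \<in> M" "reflect n f \<in> C"
      using f refl by (auto simp: N_def induced_def)
    ultimately have "reflect n f \<in> D" "reflect n f \<in> M"
      using pr_a_closed[OF n, of "reflect n f"] by (auto simp: D_def)
    then have "reflect n f = 0" by (rule DM)
    then show ?thesis
      using reflect_reflect[OF n fA] by (simp add: r.zero)
  qed
  show inj: "inj_on (pr_a n) N"
    using p.inj_on_iff_eq_0[OF subN] kernel by blast
  show im: "pr_a n ` N = M"
  proof
    show "pr_a n ` N \<subseteq> M" by (auto simp: N_def induced_def)
    show "M \<subseteq> pr_a n ` N"
    proof
      fix m assume m: "m \<in> M"
      then obtain f where f: "f \<in> C" "m = pr_a n f" using M(2) by blast
      then obtain d m' where d: "d \<in> D" "m' \<in> M" "pr_a n (reflect n f) = d + m'"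
        using split_E[of "pr_a n (reflect n f)"] refl by blast
      have dcyc: "d \<in> carrier (cyclic_algebra n)" "d \<in> carrier (dihedral_algebra n)"
        using d(1) Dcyc cyclic_subset_dihedral_algebra[OF n] by auto
      \<comment> \<open>Subtracting \<open>b d\<close>, an element of \<open>C\<close>, changes only the second component, to \<open>m'\<close>.\<close>
      let ?g = "f - reflect n d"
      have "?g \<in> C"
        using f d refl by (intro fs.subspace_diff[OF subC]) (auto simp: D_def)
      moreover have pm: "pr_a n ?g = m"
        by (simp add: p.diff f pr_a_reflect_cyclic[OF n dcyc(1)])
      moreover have "pr_a n (reflect n ?g) = m'"
        by (simp add: p.diff r.diff d(3) reflect_reflect[OF n dcyc(2)] pr_a_cyclic[OF n dcyc(1)])
      ultimately have "?g \<in> N"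
        using m d(2) CA by (auto simp: N_def induced_def)
      with pm show "m \<in> pr_a n ` N" by blast
    qed
  qed
  have reflN_eq: "reflect n ` N = N"
    using reflN NA reflect_reflect[OF n] by (force simp: image_iff)
  have "inj_on (pr_a n \<circ> reflect n) N"
    using inj inj_on_subset[OF inj_on_reflect[OF n] NA] by (intro comp_inj_on) (simp_all add: reflN_eq)
  then show "inj_on (\<lambda>f. pr_a n (reflect n f)) N" by (simp add: comp_def)
  show "(\<lambda>f. pr_a n (reflect n f)) ` N = M"
    using im reflN_eq by (metis image_image)
qed

section \<open>Generating matrices\<close>

lemma generating_matrix_of_basis_list:
  assumes "basis_list I bs" "I \<subseteq> carrier (dihedral_algebra n)"
  shows "generating_matrix n I (mat_of_rows (2 * n) (map (phi n) bs))"
proof -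
  have "vectorspace.basis class_ring ((dihedral_algebra n)\<lparr>carrier := id ` I\<rparr>) (id ` set bs)"
    using assms
    by (intro basis_list_imp_basis) (auto simp: dihedral_algebra_def vectorspace_group_algebra fun_eq_iff
        simp del: group_algebra_simps(1))
  then show ?thesis
    using assms by (auto simp: generating_matrix_def basis_list_def)
qed

lemma cyclic_generating_matrix_of_basis_list:
  fixes J :: "(bool \<times> nat \<Rightarrow> 'k::field) set"
  assumes n: "2 \<le> n" and bs: "basis_list J bs" and J: "J \<subseteq> carrier (cyclic_algebra n)"
  shows "cyclic_generating_matrix n (psi n ` J) (mat_of_rows n (map (psi n) bs))"
proof -
  have inj: "inj_on (psi n) J"
  proof (rule inj_onI)
    fix f g assume fg: "f \<in> J" "g \<in> J" "psi n f = psi n g"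
    have in_cyclic: "f \<in> carrier (cyclic_algebra n)" "g \<in> carrier (cyclic_algebra n)"
      using fg J by blast+
    have "f (s, k) = g (s, k)" for s k
    proof (cases "s \<or> \<not> k < n")
      case True
      then have "f (s, k) = 0" "g (s, k) = 0"
        using in_cyclic unfolding carrier_cyclic_algebra[OF n] by blast+
      then show ?thesis by simp
    next
      case False
      then show ?thesis
        using arg_cong[OF fg(3), of "\<lambda>v. v $ k"] by (simp add: psi_def)
    qed
    then show "f = g" by (auto simp: fun_eq_iff)
  qed
  have "vectorspace.basis class_ring ((module_vec TYPE('k) n)\<lparr>carrier := psi n ` J\<rparr>) (psi n ` set bs)"
    using inj by (intro basis_list_imp_basis vec_vs bs) (auto simp: psi_def module_vec_simps)
  moreover have "rows (mat_of_rows n (map (psi n) bs)) = map (psi n) bs"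
    by (intro rows_mat_of_rows) (auto simp: psi_def)
  moreover have "distinct (map (psi n) bs)"
    using bs inj basis_list_subset[OF bs] by (auto simp: distinct_map basis_list_def intro: inj_on_subset)
  ultimately show ?thesis
    by (simp add: cyclic_generating_matrix_def)
qed

lemma mat_of_rows_append:
  "mat_of_rows nc (xs @ ys) = mat_of_rows nc xs @\<^sub>r mat_of_rows nc ys"
  by (intro eq_matI) (auto simp: append_rows_def mat_of_rows_def nth_append)

text \<open>
  The row of an element is the row of its first component followed by that of its second; the
  next two lemmas turn lists of elements into block matrices accordingly.
\<close>

lemma mat_of_rows_phi_direct_sum:
  assumes n: "2 \<le> n" and as: "set as \<subseteq> carrier (cyclic_algebra n)" and bs: "set bs \<subseteq> carrier (cyclic_algebra n)"
  shows "mat_of_rows (2 * n) (map (phi n) (as @ map (reflect n) bs)) =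
    four_block_mat (mat_of_rows n (map (psi n) as)) (0\<^sub>m (length as) n)
      (0\<^sub>m (length bs) n) (mat_of_rows n (map (psi n) bs))" (is "?L = ?R")
proof (rule eq_matI)
  have as': "(as ! i) (True, k) = 0" if "i < length as" for i k
    using as nth_mem[OF that] n by (auto simp: carrier_cyclic_algebra)
  have bs': "(bs ! i) (True, k) = 0" if "i < length bs" for i k
    using bs nth_mem[OF that] n by (auto simp: carrier_cyclic_algebra)
  fix i j assume ij: "i < dim_row ?R" "j < dim_col ?R"
  then show "?L $$ (i, j) = ?R $$ (i, j)"
    using as'[of i "j - n"] bs'[of "i - length as" j]
    by (auto simp: mat_of_rows_def nth_append phi_def psi_def reflect_apply[OF n])
qed auto

lemma mat_of_rows_phi:
  assumes n: "2 \<le> n"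
  shows "mat_of_rows (2 * n) (map (phi n) fs) =
    append_cols (mat_of_rows n (map (psi n) (map (pr_a n) fs)))
      (mat_of_rows n (map (psi n) (map (\<lambda>f. pr_a n (reflect n f)) fs)))"
  by (rule eq_matI)
    (auto simp: append_cols_def mat_of_rows_def phi_def psi_def reflect_apply[OF n] pr_a_apply[OF n])

lemma mat_of_rows_basis_change:
  assumes S: "S \<in> carrier_mat m m" and m: "length as = m" "length bs = m"
    and bs: "\<And>i. i < m \<Longrightarrow> bs ! i = (\<Sum>j<m. fscale (S $$ (i, j)) (as ! j))"
  shows "mat_of_rows n (map (psi n) bs) = S * mat_of_rows n (map (psi n) as)"
proof (rule eq_matI)
  fix i k
  assume "i < dim_row (S * mat_of_rows n (map (psi n) as))" "k < dim_col (S * mat_of_rows n (map (psi n) as))"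
  then have ik: "i < m" "k < n" using S by auto
  have "mat_of_rows n (map (psi n) bs) $$ (i, k) = (\<Sum>j<m. fscale (S $$ (i, j)) (as ! j)) (False, k)"
    using ik m bs[OF ik(1)] by (simp add: mat_of_rows_def psi_def)
  also have "\<dots> = (\<Sum>j<m. S $$ (i, j) * (as ! j) (False, k))"
    by (simp add: sum_fun_apply)
  also have "\<dots> = (S * mat_of_rows n (map (psi n) as)) $$ (i, k)"
    using ik S m by (simp add: scalar_prod_def mat_of_rows_def psi_def atLeast0LessThan)
  finally show "mat_of_rows n (map (psi n) bs) $$ (i, k) = (S * mat_of_rows n (map (psi n) as)) $$ (i, k)" .
qed (use S m in auto)

theorem corollary8:
  fixes n :: nat and C :: "(bool \<times> nat \<Rightarrow> 'a :: {field, finite}) set"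
  assumes "2 \<le> n" and "coprime CARD('a) n"
    and "dihedral_code n C"
  shows "\<exists>k m D E G1 G2 G3 G4 S1 S2.
    cyclic_code n D \<and> cyclic_code n E \<and>
    G1 \<in> carrier_mat k n \<and> G2 \<in> carrier_mat k n \<and>
    G3 \<in> carrier_mat m n \<and> G4 \<in> carrier_mat m n \<and>
    cyclic_generating_matrix n D G1 \<and> cyclic_generating_matrix n D G2 \<and>
    cyclic_generating_matrix n E G3 \<and> cyclic_generating_matrix n E G4 \<and>
    S1 \<in> carrier_mat k k \<and> invertible_mat S1 \<and> G2 = S1 * G1 \<and>
    S2 \<in> carrier_mat m m \<and> invertible_mat S2 \<and> G4 = S2 * G3 \<and>
    generating_matrix n C
      (four_block_mat G1 (0\<^sub>m k n) (0\<^sub>m k n) G2 @\<^sub>r append_cols G3 G4) \<and>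
    generating_matrix n (C_ext n C)
      (four_block_mat G1 (0\<^sub>m k n) (0\<^sub>m k n) G2 @\<^sub>r four_block_mat G3 (0\<^sub>m m n) (0\<^sub>m m n) G4) \<and>
    generating_matrix n (C_int n C)
      (four_block_mat G1 (0\<^sub>m k n) (0\<^sub>m k n) G2)"
proof -
  note n = \<open>2 \<le> n\<close>
  define D where "D = C \<inter> carrier (cyclic_algebra n)"
  define E where "E = pr_a n ` C"
  have C: "invariant_subspace (dihedral n) C"
    using assms(3) dihedral_code_iff[OF n] by blast
  have D: "invariant_subspace (rotation_group n) D" and E: "invariant_subspace (rotation_group n) E"
    unfolding D_def E_def by (intro invariant_cyclic_part invariant_projection n C)+
  have DE: "D \<subseteq> E"
    using pr_a_cyclic[OF n] by (force simp: D_def E_def)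
  have fin: "finite (carrier (rotation_group n))" and card: "card (carrier (rotation_group n)) = n"
    using n by (simp_all add: rotations_eq card_cartesian_product)
  have comm: "comm_group (rotation_group n)" by (rule comm_group_rotations[OF n])
  then have grp: "group (rotation_group n)" by (simp add: comm_group.axioms(2))
  have nz: "(of_nat (card (carrier (rotation_group n))) :: 'a) \<noteq> 0"
    unfolding card by (rule of_nat_nonzero_if_coprime_card[OF assms(2)])
  obtain M where M: "invariant_subspace (rotation_group n) M" "M \<subseteq> E" "D \<inter> M = {0}"
    "\<forall>e\<in>E. \<exists>d\<in>D. \<exists>m\<in>M. e = d + m"
    using invariant_complement[OF grp fin nz D E DE] by blast
  define N where "N = C \<inter> induced n M"
  note dec = dihedral_code_decomposition[OF n C M[unfolded D_def E_def], folded D_def E_def N_def]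
  note subspaceD = invariant_rotation_group_iff[OF n, THEN iffD1]
  have Dcyc: "D \<subseteq> carrier (cyclic_algebra n)" "fs.subspace D"
    and Mcyc: "M \<subseteq> carrier (cyclic_algebra n)" "fs.subspace M"
    using D M(1) by (blast dest: subspaceD)+
  have CA: "C \<subseteq> carrier (dihedral_algebra n)" "fs.subspace C"
    using C by (simp_all add: invariant_dihedral_iff[OF n])
  have indA: "induced n J \<subseteq> carrier (dihedral_algebra n)" for J :: "(bool \<times> nat \<Rightarrow> 'a) set"
    by (auto simp: induced_def)
  have "fs.subspace (induced n M)"
    using invariant_induced[OF n M(1)] by (simp add: invariant_subspace_def)
  then have N: "fs.subspace N"
    unfolding N_def using CA(2) by (intro fs.subspace_inter)
  have finA: "finite (carrier (dihedral_algebra n :: ('a, _) module))"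
    unfolding dihedral_algebra_def by (rule finite_group_algebra) simp
  have "finite D" "finite N"
    using finA CA(1) by (auto simp: D_def N_def intro: finite_subset)
  then obtain ds ns where ds: "basis_list D ds" and ns: "basis_list N ns"
    using basis_list_exists Dcyc(2) N by metis
  define gs where "gs = map (pr_a n) ns"
  define hs where "hs = map (\<lambda>f. pr_a n (reflect n f)) ns"
  have "flinear (\<lambda>f. pr_a n (reflect n f))"
    by (rule flinearI) (auto simp: fun_eq_iff pr_a_def reflect_def translate_def)
  then have gs: "basis_list M gs" and hs: "basis_list M hs"
    unfolding gs_def hs_def
    using basis_list_map[OF ns flinear_pr_a dec(4)] basis_list_map[OF ns _ dec(6)] dec(5,7) by auto
  define k where "k = length ds"
  define m where "m = length ns"
  have len: "length ds = k" "length gs = m" "length hs = m"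
    by (simp_all add: k_def m_def gs_def hs_def)
  obtain S where S: "S \<in> carrier_mat m m" "invertible_mat S"
    "\<And>i. i < m \<Longrightarrow> hs ! i = (\<Sum>j<m. fscale (S $$ (i, j)) (gs ! j))"
    using basis_change_matrix[OF gs hs len(2,3)] by blast
  define G where "G = mat_of_rows n (map (psi n) ds)"
  define G3 where "G3 = mat_of_rows n (map (psi n) gs)"
  define G4 where "G4 = mat_of_rows n (map (psi n) hs)"
  have cyc: "set ds \<subseteq> carrier (cyclic_algebra n)" "set gs \<subseteq> carrier (cyclic_algebra n)"
    "set hs \<subseteq> carrier (cyclic_algebra n)"
    using basis_list_subset[OF ds] basis_list_subset[OF gs] basis_list_subset[OF hs] Dcyc(1) Mcyc(1) by auto
  have basD: "basis_list (induced n D) (ds @ map (reflect n) ds)"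
    by (rule basis_list_induced[OF n Dcyc(1) ds ds])
  have basM: "basis_list (induced n M) (gs @ map (reflect n) hs)"
    by (rule basis_list_induced[OF n Mcyc(1) gs hs])
  have "induced n D \<inter> N = {0}"
    using dec(1) fs.subspace_0[OF N] by (auto simp: N_def)
  then have basC: "basis_list C ((ds @ map (reflect n) ds) @ ns)"
    by (subst dec(2)) (rule basis_list_append[OF basD ns])
  have basE: "basis_list (induced n E) ((ds @ map (reflect n) ds) @ (gs @ map (reflect n) hs))"
    by (subst dec(3)) (rule basis_list_append[OF basD basM dec(1)])
  have blockD: "mat_of_rows (2 * n) (map (phi n) (ds @ map (reflect n) ds)) =
      four_block_mat G (0\<^sub>m k n) (0\<^sub>m k n) G"
    using mat_of_rows_phi_direct_sum[OF n cyc(1,1)] by (simp only: G_def len)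
  have blockM: "mat_of_rows (2 * n) (map (phi n) (gs @ map (reflect n) hs)) =
      four_block_mat G3 (0\<^sub>m m n) (0\<^sub>m m n) G4"
    using mat_of_rows_phi_direct_sum[OF n cyc(2,3)] by (simp only: G3_def G4_def len)
  have rowsN: "mat_of_rows (2 * n) (map (phi n) ns) = append_cols G3 G4"
    unfolding G3_def G4_def gs_def hs_def by (rule mat_of_rows_phi[OF n])
  have ideal: "cyclic_code n (psi n ` J)" if "invariant_subspace (rotation_group n) J" for J :: "(bool \<times> nat \<Rightarrow> 'a) set"
    using ideal_of_comm_group_algebra[OF comm fin that] by (auto simp: cyclic_code_def cyclic_algebra_def)
  have ext: "C_ext n C = induced n E"
    unfolding C_ext_def E_def[symmetric] by (rule left_ideal_generated_cyclic[OF n E])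
  have int: "C_int n C = induced n D"
    unfolding C_int_def D_def[symmetric] by (rule left_ideal_generated_cyclic[OF n D])
  have "generating_matrix n C (four_block_mat G (0\<^sub>m k n) (0\<^sub>m k n) G @\<^sub>r append_cols G3 G4)"
    using generating_matrix_of_basis_list[OF basC CA(1)]
    by (simp only: map_append[of _ _ ns] mat_of_rows_append[of _ _ "map _ ns"] blockD rowsN)
  moreover have "generating_matrix n (C_ext n C)
      (four_block_mat G (0\<^sub>m k n) (0\<^sub>m k n) G @\<^sub>r four_block_mat G3 (0\<^sub>m m n) (0\<^sub>m m n) G4)"
    unfolding ext using generating_matrix_of_basis_list[OF basE indA]
    by (simp only: map_append[of _ "ds @ _"] mat_of_rows_append[of _ "map _ (ds @ _)"] blockD blockM)
  moreover have "generating_matrix n (C_int n C) (four_block_mat G (0\<^sub>m k n) (0\<^sub>m k n) G)"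
    unfolding int using generating_matrix_of_basis_list[OF basD indA] by (simp only: blockD)
  moreover have "G4 = S * G3"
    unfolding G3_def G4_def by (rule mat_of_rows_basis_change[OF S(1) len(2,3) S(3)])
  moreover have "G = 1\<^sub>m k * G" "G \<in> carrier_mat k n" "G3 \<in> carrier_mat m n" "G4 \<in> carrier_mat m n"
    by (simp_all add: G_def G3_def G4_def len carrier_matI)
  moreover have "invertible_mat (1\<^sub>m k :: 'a mat)"
    unfolding invertible_mat_def inverts_mat_def by (auto intro!: exI[of _ "1\<^sub>m k"])
  moreover have "cyclic_generating_matrix n (psi n ` D) G" "cyclic_generating_matrix n (psi n ` M) G3"
      "cyclic_generating_matrix n (psi n ` M) G4"
    unfolding G_def G3_def G4_def
    by (intro cyclic_generating_matrix_of_basis_list n ds gs hs Dcyc(1) Mcyc(1))+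
  ultimately show ?thesis
    using ideal[OF D] ideal[OF M(1)] S(1,2) one_carrier_mat[of k]
    by - (rule exI[of _ k], rule exI[of _ m], rule exI[of _ "psi n ` D"], rule exI[of _ "psi n ` M"],
      rule exI[of _ G], rule exI[of _ G], rule exI[of _ G3], rule exI[of _ G4],
      rule exI[of _ "1\<^sub>m k"], rule exI[of _ S], intro conjI)
qed

end
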